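(* Assume the setting and notation of the context. Let $(\lambda_n)_{n\in\mathbb{N}}$ be a positive bounded sequence. Assume that $n/k_n=h(n)$ for some function $h$ which is regularly varying with an index $\kappa\in(0,1]$, that $k_{n-1}/k_n-1=o(\lambda_n)$, and that $\sup_{c\in[c_0,1]}\lambda_{\lfloor cn\rfloor}/\lambda_n=O(1)$ for all $c_0>0$ (as $n\to\infty$). Assume moreover: (M) for all $0<y_0<y_1<\infty$, $$\sup_{t\in[0,1]}\sup_{y\in[y_0,y_1]}\Big|\frac{U_t(yn/k_n)-U_t(n/k_n)}{a_t(n/k_n)}-\frac{y^{\gamma_t}-1}{\gamma_t}\Big|=o(\lambda_n);$$ (S) there exists a constant $\tau<\tau_{\max}:=\inf_{t\in[0,1]}1/\gamma_t^-$ such that for all $\varepsilon>0$ $$\sup_{|s-t|\le\delta_n}P\Big\{\frac{|X_s-X_t|}{a_t(n/k_n)}>\varepsilon\lambda_n,\ X_t>U_t(n/k_n)+\tau a_t(n/k_n)\Big\}=o(\lambda_nk_n/n).$$ Then $$\sup_{|s-t|\le\delta_n}\sup_{y\in[\underline y,\bar y]}\Big|\frac{U_s(yn/k_n)-U_t(n/k_n)}{a_t(n/k_n)}-\frac{y^{\gamma_t}-1}{\gamma_t}\Big|=o(\lambda_n)$$ for all $0<\underline y<\bar y<\infty$, and $$\sup_{|s-t|\le\delta_n}|\gamma_s-\gamma_t|=o(\lambda_n),\qquad \sup_{|s-t|\le\delta_n}\Big|\frac{a_s(n/k_n)}{a_t(n/k_n)}-1\Big|=o(\lambda_n),\qquad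 \sup_{|s-t|\le\delta_n}\Big|\frac{U_s(n/k_n)-U_t(n/k_n)}{a_t(n/k_n)}\Big|=o(\lambda_n).$$
   Context: Setting. $X^{(i)}=(X^{(i)}_t)_{t\in[0,1]}$, $i\in\mathbb{N}$, are iid random processes with continuous sample paths, and $X$ denotes a process with the same distribution as $X^{(1)}$; $F_t$ is the cdf of $X_t$, $F_t^{\leftarrow}$ its generalized inverse, and $U_t(u):=F_t^{\leftarrow}(1-1/u)$ for real $u>1$. There are positive normalizing functions $a_t(u)$ ($t\in[0,1]$, $u>0$) such that, with $b_t(n)=U_t(n)$, $$\Big(\max_{1\le i\le n}\frac{X^{(i)}_t-b_t(n)}{a_t(n)}\Big)_{t\in[0,1]}\to (Y_t)_{t\in[0,1]}$$ weakly in $C[0,1]$ as $n\to\infty$, where $Y$ is a max-stable process with margins $P\{Y_t\le y\}=\exp(-(1+\gamma_t y)^{-1/\gamma_t})$ for $1+\gamma_t y>0$ (read as $\exp(-e^{-y})$ if $\gamma_t=0$), for some continuous function $t\mapsto\gamma_t\in\mathbb{R}$ on $[0,1]$. The expression $(y^{\gamma}-1)/\gamma$ is read as $\log y$ if $\gamma=0$. $\gamma_t^-:=\max(-\gamma_t,0)$ and $1/0:=\infty$ (so $\tau_{\max}=\infty$ if $\gamma_t\ge0$ for all $t$). $(k_n)_{n\in\mathbb{N}}$ is an intermediate sequence: $k_n\in\{1,\dots,n\}$, $k_n\to\infty$, $k_n/n\to0$. Grid. For each $n$, points $t_{n,1}<t_{n,2}<\dots<t_{n,j_n}$ in $[0,1]$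 are given. With $t_{n,0}:=0$, $t_{n,j_n+1}:=1$, put $\delta_n:=\max_{1\le j\le j_n+1}(t_{n,j}-t_{n,j-1})$; it is assumed that $\delta_n\to0$ as $n\to\infty$. The notation $\sup_{|s-t|\le\delta_n}$ means the supremum over all $s,t\in[0,1]$ with $|s-t|\le\delta_n$. All $o(\cdot)$ and $O(\cdot)$ are for $n\to\infty$. *)

theory Defs
  imports "HOL-Probability.Probability" "HOL-Library.Landau_Symbols"
begin

section \<open>Processes indexed by the unit interval\<close>

text \<open>A process is a function \<^term>\<open>Z :: real \<Rightarrow> 'a \<Rightarrow> real\<close>; only its values at indices in
  \<^term>\<open>{0..1::real}\<close> matter. Restricting a path to the unit interval makes it an element of the
  extensional function space underlying both the product \<open>\<sigma>\<close>-algebra and the metric space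
  $C[0,1]$ below.\<close>

definition path01 :: "(real \<Rightarrow> 'a \<Rightarrow> real) \<Rightarrow> 'a \<Rightarrow> (real \<Rightarrow> real)" where
  "path01 Z \<omega> = (\<lambda>t\<in>{0..1}. Z t \<omega>)"

text \<open>On continuous paths the Borel \<open>\<sigma>\<close>-algebra of the sup norm is the trace of this product
  \<open>\<sigma>\<close>-algebra, so the law of a continuous process is its distribution on this space.\<close>

definition path_algebra :: "(real \<Rightarrow> real) measure" where
  "path_algebra = PiM {0..1} (\<lambda>_. borel)"

definition continuous_process :: "'a measure \<Rightarrow> (real \<Rightarrow> 'a \<Rightarrow> real) \<Rightarrow> bool" where
  "continuous_process M Z \<longleftrightarrow>
     prob_space M \<and>
     (\<forall>t\<in>{0..1}. Z t \<in> borel_measurable M) \<and>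
     (\<forall>\<omega>\<in>space M. continuous_on {0..1} (\<lambda>t. Z t \<omega>))"

definition iid_continuous_processes ::
    "'a measure \<Rightarrow> (nat \<Rightarrow> real \<Rightarrow> 'a \<Rightarrow> real) \<Rightarrow> bool" where
  "iid_continuous_processes M X \<longleftrightarrow>
     (\<forall>i\<ge>1. continuous_process M (X i)) \<and>
     prob_space.indep_vars M (\<lambda>_. path_algebra) (\<lambda>i. path01 (X i)) {1..} \<and>
     (\<forall>i\<ge>1. distr M path_algebra (path01 (X i)) = distr M path_algebra (path01 (X 1)))"

definition C01 :: "(real \<Rightarrow> real) metric" where
  "C01 = cfunspace (top_of_set {0..1}) euclidean_metric"

text \<open>The paths have to lie in $C[0,1]$ only from some \<open>n\<close> onwards. This allows for norming
  constants that are meaningless for small \<open>n\<close>.\<close>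

definition weakly_converges_C01 ::
    "'a measure \<Rightarrow> (nat \<Rightarrow> real \<Rightarrow> 'a \<Rightarrow> real) \<Rightarrow> 'b measure \<Rightarrow> (real \<Rightarrow> 'b \<Rightarrow> real) \<Rightarrow> bool" where
  "weakly_converges_C01 M Z N Y \<longleftrightarrow>
     (\<forall>\<^sub>F n in sequentially. continuous_process M (Z n)) \<and>
     continuous_process N Y \<and>
     (\<forall>\<phi>. continuous_map (mtopology_of C01) euclideanreal \<phi> \<longrightarrow> bounded (\<phi> ` mspace C01) \<longrightarrow>
        (\<lambda>n. \<integral>\<omega>. \<phi> (path01 (Z n) \<omega>) \<partial>M) \<longlonglongrightarrow> (\<integral>\<omega>. \<phi> (path01 Y \<omega>) \<partial>N))"

text \<open>The independent copies of \<open>Y\<close> are the coordinate processes on the \<open>n\<close>-fold power of its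
  probability space.\<close>

definition max_stable_process :: "'b measure \<Rightarrow> (real \<Rightarrow> 'b \<Rightarrow> real) \<Rightarrow> bool" where
  "max_stable_process N Y \<longleftrightarrow>
     continuous_process N Y \<and>
     (\<forall>n::nat\<ge>1. \<exists>c d. (\<forall>t\<in>{0..1}. c t > (0::real)) \<and>
        distr (PiM {1..n} (\<lambda>_. N)) path_algebra
          (path01 (\<lambda>t \<omega>. Max ((\<lambda>i. (Y t (\<omega> i) - d t) / c t) ` {1..n})))
        = distr N path_algebra (path01 Y))"


section \<open>Extreme value notions\<close>

text \<open>$F^{\leftarrow}(p) = \inf \{x \mid F(x) \ge p\}$, meaningful for \<open>0 < p < 1\<close>.\<close>

definition generalized_inverse :: "(real \<Rightarrow> real) \<Rightarrow> real \<Rightarrow> real" where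
  "generalized_inverse F p = Inf {x. F x \<ge> p}"

text \<open>Meaningful for \<open>u > 1\<close> only.\<close>

definition tail_quantile :: "'a measure \<Rightarrow> (real \<Rightarrow> 'a \<Rightarrow> real) \<Rightarrow> real \<Rightarrow> real \<Rightarrow> real" where
  "tail_quantile M Z t u = generalized_inverse (cdf (distr M borel (Z t))) (1 - 1 / u)"

definition normalized_max ::
    "(nat \<Rightarrow> real \<Rightarrow> 'a \<Rightarrow> real) \<Rightarrow> (real \<Rightarrow> real \<Rightarrow> real) \<Rightarrow> (real \<Rightarrow> real \<Rightarrow> real) \<Rightarrow>
      nat \<Rightarrow> real \<Rightarrow> 'a \<Rightarrow> real" where
  "normalized_max X a b n t \<omega> = Max ((\<lambda>i. (X i t \<omega> - b t (real n)) / a t (real n)) ` {1..n})"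

definition gev_cdf :: "real \<Rightarrow> real \<Rightarrow> real" where
  "gev_cdf \<gamma> y =
     (if \<gamma> = 0 then exp (- exp (- y)) else exp (- ((1 + \<gamma> * y) powr (- 1 / \<gamma>))))"

definition box_cox :: "real \<Rightarrow> real \<Rightarrow> real" where
  "box_cox \<gamma> y = (if \<gamma> = 0 then ln y else (y powr \<gamma> - 1) / \<gamma>)"

text \<open>The division is the one on \<^typ>\<open>ereal\<close>, where \<open>1 / 0 = \<infinity>\<close>.\<close>

definition tau_max :: "(real \<Rightarrow> real) \<Rightarrow> ereal" where
  "tau_max \<gamma> = (INF t\<in>{0..1}. 1 / ereal (max (- \<gamma> t) 0))"


section \<open>Asymptotics\<close>

definition regularly_varying :: "(real \<Rightarrow> real) \<Rightarrow> real \<Rightarrow> bool" where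
  "regularly_varying h \<kappa> \<longleftrightarrow>
     h \<in> borel_measurable (lebesgue_on {0<..}) \<and>
     (\<forall>\<^sub>F x in at_top. h x > 0) \<and>
     (\<forall>c>0. ((\<lambda>x. h (c * x) / h x) \<longlongrightarrow> c powr \<kappa>) at_top)"

definition intermediate_sequence :: "(nat \<Rightarrow> nat) \<Rightarrow> bool" where
  "intermediate_sequence k \<longleftrightarrow>
     (\<forall>n\<ge>1. k n \<in> {1..n}) \<and>
     filterlim k at_top sequentially \<and>
     (\<lambda>n. real (k n) / real n) \<longlonglongrightarrow> 0"

text \<open>$\sup_{x \in S_n} |f_n(x)| = o(g_n)$ for positive \<open>g\<close>. The supremum is taken in the extended
  reals since the real one would be arbitrary for an unbounded family.\<close>

definition sup_smallo :: "(nat \<Rightarrow> 'i set) \<Rightarrow> (nat \<Rightarrow> 'i \<Rightarrow> real) \<Rightarrow> (nat \<Rightarrow> real) \<Rightarrow> bool" where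
  "sup_smallo S f g \<longleftrightarrow>
     (\<forall>c>0. \<forall>\<^sub>F n in sequentially. (SUP x\<in>S n. ereal \<bar>f n x\<bar>) \<le> ereal (c * g n))"


section \<open>The grid\<close>

text \<open>\<open>T n j\<close> is the \<open>j\<close>-th of the \<open>J n\<close> points of the \<open>n\<close>-th grid.\<close>

definition is_grid :: "(nat \<Rightarrow> nat \<Rightarrow> real) \<Rightarrow> (nat \<Rightarrow> nat) \<Rightarrow> bool" where
  "is_grid T J \<longleftrightarrow>
     (\<forall>n\<ge>1. J n \<ge> 1 \<and> T n ` {1..J n} \<subseteq> {0..1} \<and> strict_mono_on {1..J n} (T n))"

definition grid_point :: "(nat \<Rightarrow> nat \<Rightarrow> real) \<Rightarrow> (nat \<Rightarrow> nat) \<Rightarrow> nat \<Rightarrow> nat \<Rightarrow> real" where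
  "grid_point T J n j = (if j = 0 then 0 else if j = J n + 1 then 1 else T n j)"

definition mesh :: "(nat \<Rightarrow> nat \<Rightarrow> real) \<Rightarrow> (nat \<Rightarrow> nat) \<Rightarrow> nat \<Rightarrow> real" where
  "mesh T J n = Max ((\<lambda>j. grid_point T J n j - grid_point T J n (j - 1)) ` {1..J n + 1})"

definition close_pairs :: "real \<Rightarrow> (real \<times> real) set" where
  "close_pairs \<delta> = {(s, t). s \<in> {0..1} \<and> t \<in> {0..1} \<and> \<bar>s - t\<bar> \<le> \<delta>}"

end

theory Submission
  imports Defs
begin

text \<open>
  Write \<open>u = n / k\<^sub>n\<close>. Raising the exceedance probability from \<open>1 / (yu)\<close> to
  \<open>1 / (yu) + c \<lambda>\<^sub>n / u\<close> moves the quantile of \<open>X\<^sub>t\<close> by a small multiple of \<open>\<lambda>\<^sub>n a\<^sub>t(u)\<close>, by (M), and the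
  surplus of probability absorbs the event in (S). Hence \<open>U\<^sub>t(yu) - U\<^sub>s(yu) \<le> o(\<lambda>\<^sub>n) a\<^sub>t(u)\<close> for every
  fixed \<open>y\<close> beyond a threshold that depends on \<open>\<tau>\<close> and \<open>min \<gamma>\<close> only; exchanging \<open>s\<close> and \<open>t\<close> gives
  \<open>\<bar>U\<^sub>s(yu) - U\<^sub>t(yu)\<bar> = o(\<lambda>\<^sub>n (a\<^sub>s(u) + a\<^sub>t(u)))\<close>. By (M) such a closeness at three points
  \<open>v, 2v, 4v\<close> identifies the parameters: the two increments of the limit function are \<open>D\<close> and
  \<open>2\<^sup>\<gamma> D\<close>, so their ratio gives \<open>\<gamma>\<^sub>s - \<gamma>\<^sub>t\<close>, their size then gives \<open>a\<^sub>s / a\<^sub>t - 1\<close>, and the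
  expansion at \<open>v\<close> gives \<open>U\<^sub>s(u) - U\<^sub>t(u)\<close>. The expansion at general \<open>y\<close> follows from (M) at \<open>s\<close>.
\<close>

section \<open>Box-Cox transformations\<close>

lemma box_cox_1 [simp]: "box_cox g 1 = 0"
  by (simp add: box_cox_def)

text \<open>One formula covers all indices, zero included. Estimates drawn from it by the mean value
  theorem need no case distinction and stay uniform as \<open>g\<close> passes through 0.\<close>

lemma box_cox_has_derivative:
  assumes "y > 0"
  shows "(box_cox g has_real_derivative y powr (g - 1)) (at y)"
proof (cases "g = 0")
  case True
  have "(ln has_real_derivative y powr (g - 1)) (at y)"
    using assms DERIV_ln_divide[of y] by (simp add: True powr_minus_divide)
  moreover have "box_cox g = ln"
    by (auto simp: box_cox_def True)
  ultimately show ?thesis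
    by simp
next
  case False
  have "((\<lambda>y. (y powr g - 1) / g) has_real_derivative y powr (g - 1)) (at y)"
    using assms False by (auto intro!: derivative_eq_intros)
  then show ?thesis
    unfolding box_cox_def using False by simp
qed

lemma box_cox_strict_mono:
  assumes "0 < x" "x < y"
  shows "box_cox g x < box_cox g y"
proof (rule DERIV_pos_imp_increasing[OF \<open>x < y\<close>])
  fix z
  assume "x \<le> z" "z \<le> y"
  then have "z > 0"
    using assms by simp
  then show "\<exists>d. (box_cox g has_real_derivative d) (at z) \<and> d > 0"
    using box_cox_has_derivative[of z g] by (intro exI[of _ "z powr (g - 1)"]) simp
qed

text \<open>Both functions vanish at 1, and beyond 1 the derivative \<open>x powr (g - 1)\<close>
  increases with the index. A threshold found for the smallest index therefore serves all
  indices.\<close>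

lemma box_cox_mono_index:
  assumes "1 \<le> y" "g \<le> g'"
  shows "box_cox g y \<le> box_cox g' y"
proof -
  let ?f = "\<lambda>y. box_cox g' y - box_cox g y"
  have "?f 1 \<le> ?f y"
  proof (rule DERIV_nonneg_imp_nondecreasing[OF \<open>1 \<le> y\<close>])
    fix x :: real
    assume x: "1 \<le> x" "x \<le> y"
    have "(?f has_real_derivative (x powr (g' - 1) - x powr (g - 1))) (at x)"
      using x by (intro DERIV_diff box_cox_has_derivative) auto
    moreover have "x powr (g' - 1) - x powr (g - 1) \<ge> 0"
      using x assms by (simp add: powr_mono)
    ultimately show "\<exists>z. (?f has_real_derivative z) (at x) \<and> 0 \<le> z"
      by blast
  qed
  then show ?thesis
    by simp
qed

text \<open>An increment is an integral of \<open>x powr (g - 1)\<close>, and doubling the variable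
  multiplies it by \<open>2 powr g\<close>. Consecutive increments along a geometric progression
  thus reveal the index whatever the scale and location are.\<close>

lemma box_cox_geometric:
  assumes "y > 0"
  shows "box_cox g (4 * y) - box_cox g (2 * y) = 2 powr g * (box_cox g (2 * y) - box_cox g y)"
proof (cases "g = 0")
  case True
  have "ln (4 * y) = ln (2 * (2 * y))"
    by simp
  also have "\<dots> = ln 2 + ln (2 * y)"
    using assms by (subst ln_mult) auto
  finally show ?thesis
    using assms True by (simp add: box_cox_def ln_mult)
next
  case False
  have four: "4 powr g = 2 powr g * 2 powr g"
    using powr_mult[of 2 2 g] by simp
  have "box_cox g (4 * y) - box_cox g (2 * y)
      = (2 powr g * 2 powr g * y powr g - 2 powr g * y powr g) / g"
    using assms False by (simp add: box_cox_def powr_mult four diff_divide_distrib)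
  also have "\<dots> = 2 powr g * (box_cox g (2 * y) - box_cox g y)"
    using assms False by (simp add: box_cox_def powr_mult diff_divide_distrib right_diff_distrib)
  finally show ?thesis .
qed

lemma powr_bounds:
  fixes G a b :: real
  assumes "0 < a"
  obtains c C where "0 < c" "\<And>g y. \<bar>g\<bar> \<le> G \<Longrightarrow> a \<le> y \<Longrightarrow> y \<le> b \<Longrightarrow> c \<le> y powr g \<and> y powr g \<le> C"
proof -
  define B where "B = max \<bar>ln a\<bar> \<bar>ln b\<bar>"
  have "exp (- G * B) \<le> y powr g \<and> y powr g \<le> exp (G * B)"
    if "\<bar>g\<bar> \<le> G" "a \<le> y" "y \<le> b" for g y
  proof -
    have "ln a \<le> ln y" "ln y \<le> ln b"
      using that assms by auto
    then have "\<bar>ln y\<bar> \<le> B"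
      by (auto simp: B_def)
    then have "\<bar>g * ln y\<bar> \<le> G * B"
      unfolding abs_mult using that by (intro mult_mono) auto
    then show ?thesis
      using that assms by (auto simp: powr_def abs_le_iff)
  qed
  then show ?thesis
    by (intro that[of "exp (- G * B)" "exp (G * B)"]) auto
qed

text \<open>Mean value theorem: the derivative has exponent \<open>g - 1\<close>, so
  \<open>powr_bounds\<close> is used with \<open>G + 1\<close>. The positive lower constant later
  allows division by increments.\<close>

lemma box_cox_increment_bounds:
  fixes G a b :: real
  assumes "0 < a"
  obtains c C where "0 < c"
    "\<And>g x y. \<bar>g\<bar> \<le> G \<Longrightarrow> a \<le> x \<Longrightarrow> x \<le> y \<Longrightarrow> y \<le> b \<Longrightarrow>
       c * (y - x) \<le> box_cox g y - box_cox g x \<and> box_cox g y - box_cox g x \<le> C * (y - x)"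
proof -
  obtain c C where c: "0 < c"
    and cC: "\<And>g y. \<bar>g\<bar> \<le> G + 1 \<Longrightarrow> a \<le> y \<Longrightarrow> y \<le> b \<Longrightarrow> c \<le> y powr g \<and> y powr g \<le> C"
    using that by (rule powr_bounds[OF assms, of "G + 1" b])
  have "c * (y - x) \<le> box_cox g y - box_cox g x \<and> box_cox g y - box_cox g x \<le> C * (y - x)"
    if *: "\<bar>g\<bar> \<le> G" "a \<le> x" "x \<le> y" "y \<le> b" for g x y
  proof (cases "x = y")
    case False
    then have "x < y"
      using * by simp
    then obtain z where "x < z" "z < y"
      "box_cox g y - box_cox g x = (y - x) * z powr (g - 1)"
      using MVT2[OF \<open>x < y\<close>, of "box_cox g" "\<lambda>z. z powr (g - 1)"] box_cox_has_derivative * assms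
      by auto
    moreover have "c \<le> z powr (g - 1) \<and> z powr (g - 1) \<le> C"
      using * \<open>x < z\<close> \<open>z < y\<close> by (intro cC) auto
    ultimately show ?thesis
      using \<open>x < y\<close> by (simp add: mult.commute)
  qed auto
  with c show ?thesis
    by (rule that)
qed

text \<open>Increments are measured from 1, where \<open>box_cox g\<close> vanishes. For this the
  interval is enlarged to contain 1.\<close>

lemma box_cox_bounded:
  fixes G a b :: real
  assumes "0 < a"
  obtains C where "\<And>g y. \<bar>g\<bar> \<le> G \<Longrightarrow> a \<le> y \<Longrightarrow> y \<le> b \<Longrightarrow> \<bar>box_cox g y\<bar> \<le> C"
proof -
  have pos: "0 < min a 1"
    using assms by simp
  obtain c C where "0 < c" and
    cC: "\<And>g x y. \<bar>g\<bar> \<le> G \<Longrightarrow> min a 1 \<le> x \<Longrightarrow> x \<le> y \<Longrightarrow> y \<le> max b 1 \<Longrightarrow>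
       c * (y - x) \<le> box_cox g y - box_cox g x \<and> box_cox g y - box_cox g x \<le> C * (y - x)"
    using that by (rule box_cox_increment_bounds[OF pos, of G "max b 1"])
  have "\<bar>box_cox g y\<bar> \<le> \<bar>C\<bar> * (\<bar>a\<bar> + \<bar>b\<bar> + 1)" if *: "\<bar>g\<bar> \<le> G" "a \<le> y" "y \<le> b" for g y
  proof -
    have "\<bar>box_cox g y\<bar> \<le> \<bar>C\<bar> * \<bar>y - 1\<bar>"
    proof (cases "1 \<le> y")
      case True
      have "0 \<le> c * (y - 1)" "C * (y - 1) \<le> \<bar>C\<bar> * (y - 1)"
        using True \<open>0 < c\<close> by (auto intro: mult_right_mono)
      with True * cC[of g 1 y] show ?thesis
        by auto
    next
      case False
      have "0 \<le> c * (1 - y)" "C * (1 - y) \<le> \<bar>C\<bar> * (1 - y)"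
        using False \<open>0 < c\<close> by (auto intro: mult_right_mono)
      moreover have "c * (1 - y) \<le> - box_cox g y" "- box_cox g y \<le> C * (1 - y)"
        using False * cC[of g y 1] by auto
      moreover have abs: "\<bar>y - 1\<bar> = 1 - y"
        using False by simp
      ultimately show ?thesis
        unfolding abs by linarith
    qed
    also have "\<dots> \<le> \<bar>C\<bar> * (\<bar>a\<bar> + \<bar>b\<bar> + 1)"
      using * assms by (intro mult_left_mono) auto
    finally show ?thesis .
  qed
  then show ?thesis
    by (rule that)
qed

lemma powr_lipschitz_exponent:
  fixes G a b :: real
  assumes "0 < a"
  obtains C where "0 \<le> C" "\<And>g g' y. \<bar>g\<bar> \<le> G \<Longrightarrow> \<bar>g'\<bar> \<le> G \<Longrightarrow> a \<le> y \<Longrightarrow> y \<le> b \<Longrightarrow>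
    \<bar>y powr g - y powr g'\<bar> \<le> C * \<bar>g - g'\<bar>"
proof -
  obtain c C where "0 < c" and
    C: "\<And>g y. \<bar>g\<bar> \<le> G \<Longrightarrow> a \<le> y \<Longrightarrow> y \<le> b \<Longrightarrow> c \<le> y powr g \<and> y powr g \<le> C"
    using that by (rule powr_bounds[OF assms, of G b])
  define B where "B = max \<bar>ln a\<bar> \<bar>ln b\<bar>"
  have "\<bar>y powr g - y powr g'\<bar> \<le> (\<bar>C\<bar> * B) * \<bar>g - g'\<bar>"
    if *: "\<bar>g\<bar> \<le> G" "\<bar>g'\<bar> \<le> G" "a \<le> y" "y \<le> b" for g g' y
  proof -
    have "norm (y powr g - y powr g') \<le> (\<bar>C\<bar> * B) * norm (g - g')"
    proof (rule field_differentiable_bound[where S = "{-G..G}" and f' = "\<lambda>g. y powr g * ln y"])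
      fix z
      assume z: "z \<in> {-G..G}"
      show "((powr) y has_field_derivative y powr z * ln y) (at z within {-G..G})"
        using has_real_derivative_const_powr[of "\<lambda>z. z" "\<lambda>_. 1" y z, OF DERIV_ident]
        by (simp add: mult.commute has_field_derivative_at_within)
      have "ln a \<le> ln y" "ln y \<le> ln b"
        using that assms by auto
      then have "\<bar>ln y\<bar> \<le> B"
        by (auto simp: B_def)
      moreover have "y powr z \<le> C"
        using C[of z y] z * by auto
      then have "\<bar>y powr z\<bar> \<le> \<bar>C\<bar>"
        by (simp add: abs_le_iff)
      ultimately show "norm (y powr z * ln y) \<le> \<bar>C\<bar> * B"
        by (auto simp: abs_mult intro: mult_mono)
    qed (use * in auto)
    then show ?thesis
      by simp
  qed
  moreover have "0 \<le> \<bar>C\<bar> * B"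
    by (simp add: B_def)
  ultimately show ?thesis
    using that by blast
qed

text \<open>The difference of the two functions vanishes at 1, and its derivative
  \<open>y powr (g - 1) - y powr (g' - 1)\<close> is Lipschitz in the exponent. Integrating from 1
  avoids differentiating \<open>box_cox\<close> in the index, which would be delicate at 0.\<close>

lemma box_cox_lipschitz_index:
  fixes G a b :: real
  assumes "0 < a"
  obtains C where "\<And>g g' y. \<bar>g\<bar> \<le> G \<Longrightarrow> \<bar>g'\<bar> \<le> G \<Longrightarrow> a \<le> y \<Longrightarrow> y \<le> b \<Longrightarrow>
    \<bar>box_cox g y - box_cox g' y\<bar> \<le> C * \<bar>g - g'\<bar>"
proof -
  have pos: "0 < min a 1"
    using assms by simp
  obtain C where "0 \<le> C" and
    C: "\<And>g g' y. \<bar>g\<bar> \<le> G + 1 \<Longrightarrow> \<bar>g'\<bar> \<le> G + 1 \<Longrightarrow> min a 1 \<le> y \<Longrightarrow> y \<le> max b 1 \<Longrightarrow>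
    \<bar>y powr g - y powr g'\<bar> \<le> C * \<bar>g - g'\<bar>"
    using that by (rule powr_lipschitz_exponent[OF pos, of "G + 1" "max b 1"])
  have "\<bar>box_cox g y - box_cox g' y\<bar> \<le> C * (\<bar>a\<bar> + \<bar>b\<bar> + 1) * \<bar>g - g'\<bar>"
    if *: "\<bar>g\<bar> \<le> G" "\<bar>g'\<bar> \<le> G" "a \<le> y" "y \<le> b" for g g' y
  proof -
    let ?f = "\<lambda>y. box_cox g y - box_cox g' y"
    have "norm (?f y - ?f 1) \<le> (C * \<bar>g - g'\<bar>) * norm (y - 1)"
    proof (rule field_differentiable_bound[where S = "{min a 1..max b 1}"
          and f' = "\<lambda>y. y powr (g - 1) - y powr (g' - 1)"])
      fix z
      assume z: "z \<in> {min a 1..max b 1}"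
      then show "(?f has_field_derivative z powr (g - 1) - z powr (g' - 1))
          (at z within {min a 1..max b 1})"
        using assms
        by (intro has_field_derivative_at_within[OF DERIV_diff] box_cox_has_derivative) auto
      show "norm (z powr (g - 1) - z powr (g' - 1)) \<le> C * \<bar>g - g'\<bar>"
        using C[of "g - 1" "g' - 1" z] z * by auto
    qed (use * in auto)
    then have "\<bar>?f y\<bar> \<le> (C * \<bar>g - g'\<bar>) * \<bar>y - 1\<bar>"
      by simp
    also have "\<dots> \<le> (C * \<bar>g - g'\<bar>) * (\<bar>a\<bar> + \<bar>b\<bar> + 1)"
      using * assms \<open>0 \<le> C\<close> by (intro mult_left_mono) auto
    finally show ?thesis
      by (simp add: mult_ac)
  qed
  then show ?thesis
    by (rule that)
qed

text \<open>On exponents from \<open>- G\<close> upwards the derivative of \<open>2 powr g\<close>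
  is at least \<open>2 powr (- G) * ln 2\<close>. This turns closeness of increment ratios into
  closeness of indices.\<close>

lemma two_powr_inverse_lipschitz:
  fixes G :: real
  obtains C where "\<And>g g'. \<bar>g\<bar> \<le> G \<Longrightarrow> \<bar>g'\<bar> \<le> G \<Longrightarrow> \<bar>g - g'\<bar> \<le> C * \<bar>2 powr g - 2 powr g'\<bar>"
proof -
  have *: "g' - g \<le> (2 powr G / ln 2) * (2 powr g' - 2 powr g)"
    if "\<bar>g\<bar> \<le> G" "g < g'" for g g' :: real
  proof -
    obtain z where z: "g < z" "z < g'" "2 powr g' - 2 powr g = (g' - g) * (2 powr z * ln 2)"
      using MVT2[OF \<open>g < g'\<close>, of "(powr) 2" "\<lambda>z. 2 powr z * ln 2"]
        has_real_derivative_const_powr[of "\<lambda>z. z" "\<lambda>_. 1" 2, OF DERIV_ident]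
      by (auto simp: mult.commute)
    have "2 powr (- G) \<le> 2 powr z"
      using that z by simp
    then have "1 \<le> 2 powr G * 2 powr z"
      by (simp add: powr_minus field_simps)
    then have "(g' - g) * 1 \<le> (g' - g) * (2 powr G * 2 powr z)"
      using that by (intro mult_left_mono) auto
    then show ?thesis
      using z by (simp add: mult_ac)
  qed
  have "\<bar>g - g'\<bar> \<le> (2 powr G / ln 2) * \<bar>2 powr g - 2 powr g'\<bar>"
    if "\<bar>g\<bar> \<le> G" "\<bar>g'\<bar> \<le> G" for g g' :: real
    using *[of g g'] *[of g' g] that by (cases g g' rule: linorder_cases) auto
  then show ?thesis
    by (rule that)
qed

text \<open>For \<open>g < 0\<close> the value \<open>- 1 / g\<close> is the limit of
  \<open>box_cox g\<close> at infinity; for all other \<open>g\<close> the function dominates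
  \<open>ln\<close> beyond 1 and is unbounded.\<close>

lemma box_cox_exceeds:
  assumes "g < 0 \<longrightarrow> \<tau> < - 1 / g"
  obtains w where "1 \<le> w" "\<tau> < box_cox g w"
proof -
  have "\<forall>\<^sub>F w in at_top. \<tau> < box_cox g w"
  proof (cases "g < 0")
    case True
    have "((\<lambda>w. (w powr g - 1) / g) \<longlongrightarrow> (0 - 1) / g) at_top"
      using True by (intro tendsto_intros tendsto_neg_powr filterlim_ident) auto
    then have "((\<lambda>w. (w powr g - 1) / g) \<longlongrightarrow> - 1 / g) at_top"
      by simp
    from order_tendstoD(1)[OF this] show ?thesis
      using True assms by (simp add: box_cox_def)
  next
    case False
    have "\<forall>\<^sub>F w::real in at_top. \<tau> < ln w"
      using ln_at_top filterlim_at_top_dense by blast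
    with eventually_ge_at_top[of 1] show ?thesis
    proof eventually_elim
      case (elim w)
      have "ln w \<le> box_cox g w"
        using box_cox_mono_index[of w 0 g] elim False by (simp add: box_cox_def)
      then show ?case
        using elim by simp
    qed
  qed
  then have "\<forall>\<^sub>F w in at_top. 1 \<le> w \<and> \<tau> < box_cox g w"
    using eventually_ge_at_top by (rule eventually_conj[rotated])
  from eventually_happens'[OF trivial_limit_at_top_linorder this] show ?thesis
    using that by blast
qed

section \<open>Comparison of tail quantiles\<close>

text \<open>The hypothesis says that the cdf at \<open>x\<close> is below \<open>1 - 1 / u\<close>,
  so by monotonicity every candidate in the infimum lies above \<open>x\<close>.\<close>

lemma le_tail_quantile:
  assumes "prob_space M" "Z t \<in> borel_measurable M" "u > 1"
    and "measure M {\<omega> \<in> space M. Z t \<omega> > x} > 1 / u"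
  shows "x \<le> tail_quantile M Z t u"
proof -
  interpret prob_space M by fact
  let ?F = "cdf (distr M borel (Z t))"
  interpret D: real_distribution "distr M borel (Z t)"
    using assms by simp
  have F: "?F x = measure M {\<omega> \<in> space M. Z t \<omega> \<le> x}" for x
    using assms by (auto simp: cdf_def measure_distr intro!: arg_cong[where f = "measure M"])
  have "measure M {\<omega> \<in> space M. \<not> Z t \<omega> \<le> x} = 1 - ?F x"
    unfolding F using assms by (intro prob_neg) auto
  then have less: "?F x < 1 - 1 / u"
    using assms by (simp add: not_le)
  \<comment> \<open>The real infimum of the empty set would carry no information, so a candidate is
    needed; it exists because the cdf tends to 1.\<close>
  have "\<forall>\<^sub>F y in at_top. ?F y > 1 - 1 / u"
    using D.cdf_lim_at_top_prob assms by (intro order_tendstoD(1)) auto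
  from eventually_happens'[OF trivial_limit_at_top_linorder this]
  obtain y where "?F y > 1 - 1 / u"
    by blast
  then have "{z. ?F z \<ge> 1 - 1 / u} \<noteq> {}"
    by (auto intro: less_imp_le)
  moreover have "x \<le> z" if "z \<in> {z. ?F z \<ge> 1 - 1 / u}" for z
    using that less D.cdf_nondecreasing[of z x] by (cases "x \<le> z") auto
  ultimately show ?thesis
    unfolding tail_quantile_def generalized_inverse_def by (rule cInf_greatest)
qed

text \<open>Otherwise \<open>x\<close> itself would be a candidate in the infimum. The candidates
  are bounded below because the cdf tends to 0 at minus infinity while \<open>1 - 1 / u\<close> is
  positive.\<close>

lemma exceedance_prob_of_less_tail_quantile:
  assumes "prob_space M" "Z t \<in> borel_measurable M" "u > 1"
    and "x < tail_quantile M Z t u"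
  shows "measure M {\<omega> \<in> space M. Z t \<omega> > x} > 1 / u"
proof -
  interpret prob_space M by fact
  let ?F = "cdf (distr M borel (Z t))"
  interpret D: real_distribution "distr M borel (Z t)"
    using assms by simp
  have F: "?F x = measure M {\<omega> \<in> space M. Z t \<omega> \<le> x}" for x
    using assms by (auto simp: cdf_def measure_distr intro!: arg_cong[where f = "measure M"])
  have "measure M {\<omega> \<in> space M. \<not> Z t \<omega> \<le> x} = 1 - ?F x"
    unfolding F using assms by (intro prob_neg) auto
  then have eq: "measure M {\<omega> \<in> space M. Z t \<omega> > x} = 1 - ?F x"
    by (simp add: not_le)
  have "\<forall>\<^sub>F y in at_bot. ?F y < 1 - 1 / u"
    using D.cdf_lim_at_bot assms by (intro order_tendstoD(2)) auto
  from eventually_happens'[OF trivial_limit_at_bot_linorder this]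
  obtain y where y: "?F y < 1 - 1 / u"
    by blast
  have "y \<le> z" if "?F z \<ge> 1 - 1 / u" for z
    using that y D.cdf_nondecreasing[of z y] by (cases "y \<le> z") auto
  then have bdd: "bdd_below {z. ?F z \<ge> 1 - 1 / u}"
    by (intro bdd_belowI) auto
  have "\<not> ?F x \<ge> 1 - 1 / u"
  proof
    assume "?F x \<ge> 1 - 1 / u"
    then have "tail_quantile M Z t u \<le> x"
      unfolding tail_quantile_def generalized_inverse_def using bdd by (intro cInf_lower) auto
    then show False
      using assms by simp
  qed
  then show ?thesis
    using eq by simp
qed

text \<open>For \<open>x\<close> strictly between \<open>m\<close> and the quantile at
  \<open>t\<close>, the event \<open>Z t > x\<close> has probability above \<open>1 / u\<close> and
  lies in the union of \<open>Z s > x - d\<close> with the exceptional event. The first of these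
  then has probability above \<open>1 / u - q\<close>, hence above \<open>1 / v\<close>. Letting
  \<open>x\<close> increase to the quantile gives the claim.\<close>

lemma tail_quantile_comparison:
  assumes "prob_space M" "Z s \<in> borel_measurable M" "Z t \<in> borel_measurable M"
    and u: "u > 1" "v > 1" "1 / v + q \<le> 1 / u"
    and q: "measure M {\<omega> \<in> space M. \<bar>Z s \<omega> - Z t \<omega>\<bar> > d \<and> Z t \<omega> > m} \<le> q"
    and m: "m < tail_quantile M Z t u"
  shows "tail_quantile M Z t u - d \<le> tail_quantile M Z s v"
proof -
  interpret prob_space M by fact
  note [measurable] = assms(2,3)
  have "x \<le> tail_quantile M Z s v + d" if x: "m < x" "x < tail_quantile M Z t u" for x
  proof -
    let ?A = "{\<omega> \<in> space M. Z s \<omega> > x - d}"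
      and ?B = "{\<omega> \<in> space M. \<bar>Z s \<omega> - Z t \<omega>\<bar> > d \<and> Z t \<omega> > m}"
    have "1 / u < measure M {\<omega> \<in> space M. Z t \<omega> > x}"
      using assms x by (intro exceedance_prob_of_less_tail_quantile) auto
    also have "\<dots> \<le> measure M (?A \<union> ?B)"
      using x by (intro finite_measure_mono) auto
    also have "\<dots> \<le> measure M ?A + measure M ?B"
      by (intro measure_Un_le) auto
    finally have "1 / v < measure M ?A"
      using u q by simp
    then have "x - d \<le> tail_quantile M Z s v"
      using assms by (intro le_tail_quantile) auto
    then show ?thesis
      by simp
  qed
  then have "tail_quantile M Z t u \<le> tail_quantile M Z s v + d"
    by (rule dense_le_bounded[OF m])
  then show ?thesis
    by simp
qed

text \<open>The quantile of \<open>Z t\<close> at an earlier level \<open>x * u\<close> is compared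
  with that of \<open>Z s\<close> at \<open>y * u\<close>. The bounds \<open>2 * w \<le> y\<close>
  and \<open>y * (c * l) \<le> 1\<close> keep \<open>x\<close> above \<open>w\<close>. The errors
  are \<open>\<epsilon>\<close> from the oscillation, \<open>m\<close> twice from the expansion at
  \<open>x\<close> and \<open>y\<close>, and \<open>K * y\<^sup>2 * c\<close> from moving
  \<open>x\<close> to \<open>y\<close>.\<close>

lemma tail_quantile_gap:
  fixes w y u a l m c \<epsilon> \<tau> K g :: real
  assumes M: "prob_space M" "Z s \<in> borel_measurable M" "Z t \<in> borel_measurable M"
    and "a > 0" "l \<ge> 0" "1 \<le> w" "2 * w \<le> y" "u > 1" "c \<ge> 0" "K \<ge> 0" "y * (c * l) \<le> 1"
    and expansion: "\<And>x. x \<in> {w..y} \<Longrightarrow>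
      \<bar>(tail_quantile M Z t (x * u) - tail_quantile M Z t u) / a - box_cox g x\<bar> \<le> m * l"
    and oscillation: "measure M {\<omega> \<in> space M. \<bar>Z s \<omega> - Z t \<omega>\<bar> / a > \<epsilon> * l \<and>
      Z t \<omega> > tail_quantile M Z t u + \<tau> * a} \<le> c * l / u"
    and margin: "\<tau> + m * l < box_cox g w"
    and increment: "\<And>x. x \<in> {w..y} \<Longrightarrow> box_cox g y - box_cox g x \<le> K * (y - x)"
  shows "tail_quantile M Z t (y * u) - tail_quantile M Z s (y * u) \<le> (\<epsilon> + 2 * m + K * y\<^sup>2 * c) * l * a"
proof -
  \<comment> \<open>the point with \<open>1 / x = 1 / y + c l\<close>\<close>
  define x where "x = y / (1 + y * (c * l))"
  let ?U = "tail_quantile M Z"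
  have "y > 0"
    using assms by simp
  have cl: "0 \<le> y * (c * l)"
    using assms by simp
  have "w * (1 + y * (c * l)) \<le> w * 2"
    using assms by (intro mult_left_mono) auto
  also have "w * 2 \<le> y"
    using \<open>2 * w \<le> y\<close> by simp
  finally have "w \<le> x"
    using cl by (simp add: x_def pos_le_divide_eq)
  have "x \<le> y"
    using cl \<open>y > 0\<close> mult_left_mono[of 1 "1 + y * (c * l)" y] by (simp add: x_def pos_divide_le_eq)
  have "y - x = x * (y * (c * l))"
    using cl by (simp add: x_def field_simps)
  also have "\<dots> \<le> y * (y * (c * l))"
    using cl \<open>x \<le> y\<close> by (rule mult_right_mono[rotated])
  finally have "y - x \<le> y\<^sup>2 * c * l"
    by (simp add: power2_eq_square mult_ac)
  then have "K * (y - x) \<le> K * (y\<^sup>2 * c * l)"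
    using assms by (intro mult_left_mono)
  then have incr: "box_cox g y - box_cox g x \<le> K * y\<^sup>2 * c * l"
    using increment[of x] \<open>w \<le> x\<close> \<open>x \<le> y\<close> by (simp add: mult_ac)
  \<comment> \<open>Monotonicity and the margin at \<open>w\<close> put the quantile at level
    \<open>x * u\<close> above the threshold in the oscillation bound, as the comparison
    requires.\<close>
  have "box_cox g w \<le> box_cox g x"
    using box_cox_strict_mono[of w x g] assms \<open>w \<le> x\<close> by (cases "w = x") auto
  moreover have ex: "\<bar>(?U t (x * u) - ?U t u) / a - box_cox g x\<bar> \<le> m * l"
    using \<open>w \<le> x\<close> \<open>x \<le> y\<close> by (intro expansion) auto
  ultimately have "\<tau> < (?U t (x * u) - ?U t u) / a"
    using margin by linarith
  then have *: "?U t u + \<tau> * a < ?U t (x * u)"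
    using \<open>a > 0\<close> by (simp add: field_simps)
  have "?U t (x * u) - \<epsilon> * l * a \<le> ?U s (y * u)"
  proof (rule tail_quantile_comparison[OF M _ _ _ _ *])
    have "1 \<le> x" "1 \<le> y"
      using \<open>1 \<le> w\<close> \<open>w \<le> x\<close> \<open>x \<le> y\<close> by auto
    then have "1 * u \<le> x * u" "1 * u \<le> y * u"
      using \<open>u > 1\<close> by (auto intro!: mult_right_mono)
    then show "1 < x * u" "1 < y * u"
      using \<open>u > 1\<close> by linarith+
    have "1 / x = 1 / y + c * l"
      using \<open>y > 0\<close> by (simp add: x_def field_simps)
    then have "1 / (x * u) = 1 / (y * u) + c * l / u"
      by (metis add_divide_distrib divide_divide_eq_left)
    then show "1 / (y * u) + c * l / u \<le> 1 / (x * u)"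
      by simp
    show "measure M {\<omega> \<in> space M. \<bar>Z s \<omega> - Z t \<omega>\<bar> > \<epsilon> * l * a \<and> Z t \<omega> > ?U t u + \<tau> * a} \<le> c * l / u"
      using oscillation \<open>a > 0\<close> by (simp add: pos_less_divide_eq)
  qed
  moreover have "(?U t (y * u) - ?U t (x * u)) / a \<le> (2 * m + K * y\<^sup>2 * c) * l"
    using ex expansion[of y] incr \<open>w \<le> x\<close> \<open>x \<le> y\<close>
    unfolding diff_divide_distrib by (simp add: algebra_simps)
  then have "?U t (y * u) - ?U t (x * u) \<le> (2 * m + K * y\<^sup>2 * c) * l * a"
    using \<open>a > 0\<close> by (simp add: pos_divide_le_eq)
  ultimately show ?thesis
    by (simp add: algebra_simps)
qed

section \<open>Uniform asymptotics\<close>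

text \<open>Convergence along this filter is convergence in \<open>n\<close> uniformly over \<open>S n\<close>, which makes the
  Landau symbols of the library available for uniform estimates.\<close>

definition uniformly_in :: "(nat \<Rightarrow> 'i set) \<Rightarrow> (nat \<times> 'i) filter" where
  "uniformly_in S = inf (filtercomap fst sequentially) (principal (Sigma UNIV S))"

lemma eventually_uniformly_in:
  "eventually P (uniformly_in S) \<longleftrightarrow> (\<forall>\<^sub>F n in sequentially. \<forall>x\<in>S n. P (n, x))"
proof -
  have "eventually P (uniformly_in S)
      \<longleftrightarrow> (\<exists>Q. eventually Q sequentially \<and> (\<forall>n x. Q n \<longrightarrow> x \<in> S n \<longrightarrow> P (n, x)))"
    unfolding uniformly_in_def eventually_inf_principal eventually_filtercomap by auto
  also have "\<dots> \<longleftrightarrow> (\<forall>\<^sub>F n in sequentially. \<forall>x\<in>S n. P (n, x))"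
    by (auto elim: eventually_mono)
  finally show ?thesis .
qed

text \<open>Composing a Landau symbol with this limit carries a uniform estimate from the indices
  \<open>S'\<close> to the indices \<open>S\<close>.\<close>

lemma filterlim_uniformly_in:
  assumes "\<And>n x. x \<in> S n \<Longrightarrow> h x \<in> S' n"
  shows "filterlim (\<lambda>z. (fst z, h (snd z))) (uniformly_in S') (uniformly_in S)"
  unfolding filterlim_iff eventually_uniformly_in using assms by (auto elim: eventually_mono)

lemma sup_smallo_iff_smallo:
  assumes "\<And>n. n \<ge> 1 \<Longrightarrow> g n > 0"
  shows "sup_smallo S f g \<longleftrightarrow> (\<lambda>z. f (fst z) (snd z)) \<in> o[uniformly_in S](\<lambda>z. g (fst z))"
proof -
  have "(\<forall>\<^sub>F n in sequentially. (SUP x\<in>S n. ereal \<bar>f n x\<bar>) \<le> ereal (c * g n)) \<longleftrightarrow>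
      (\<forall>\<^sub>F n in sequentially. \<forall>x\<in>S n. \<bar>f n x\<bar> \<le> c * \<bar>g n\<bar>)" for c
  proof (intro eventually_cong eventually_mono[OF eventually_ge_at_top[of 1]] refl)
    fix n :: nat
    assume "1 \<le> n"
    then have "g n > 0"
      by (rule assms)
    then show "(SUP x\<in>S n. ereal \<bar>f n x\<bar>) \<le> ereal (c * g n) \<longleftrightarrow> (\<forall>x\<in>S n. \<bar>f n x\<bar> \<le> c * \<bar>g n\<bar>)"
      by (simp add: SUP_le_iff)
  qed
  then show ?thesis
    unfolding sup_smallo_def smallo_def by (simp add: eventually_uniformly_in)
qed

lemma sup_smallo_eventually:
  assumes "sup_smallo S f g" "c > 0"
  shows "\<forall>\<^sub>F n in sequentially. \<forall>x\<in>S n. \<bar>f n x\<bar> \<le> c * g n"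
  using assms unfolding sup_smallo_def by (simp add: SUP_le_iff)

lemma smallo_mult_bounded:
  fixes f c l :: "'z \<Rightarrow> real"
  assumes "f \<in> o[F](l)" "c \<in> O[F](\<lambda>_. 1)"
  shows "(\<lambda>z. c z * f z) \<in> o[F](l)"
  using landau_o.big_small_mult[OF assms(2,1)] by simp

lemma smallo_eventually_eq:
  fixes f g l :: "'z \<Rightarrow> real"
  assumes "f \<in> o[F](l)" "\<forall>\<^sub>F z in F. f z = g z"
  shows "g \<in> o[F](l)"
  using landau_o.small.in_cong[OF assms(2)] assms(1) by blast

text \<open>In the application \<open>Q y\<close> and \<open>Q' y\<close> are the quantiles at level
  \<open>y * u\<close> for the two indices of a close pair, with scales \<open>p\<close> and
  \<open>q\<close>. The ratio \<open>p / q\<close> enters the error in \<open>close\<close> and must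
  first be shown bounded; afterwards all errors are o(\<open>l\<close>) and the parameters are
  identified one after the other.\<close>

lemma quantile_expansion_transfer:
  fixes F :: "'z filter" and p q g g' l :: "'z \<Rightarrow> real" and Q Q' :: "real \<Rightarrow> 'z \<Rightarrow> real" and G v :: real
  assumes pos: "\<forall>\<^sub>F z in F. p z > 0 \<and> q z > 0"
    and g: "\<forall>\<^sub>F z in F. \<bar>g z\<bar> \<le> G \<and> \<bar>g' z\<bar> \<le> G"
    and l: "l \<in> O[F](\<lambda>_. 1)"
    and v: "v > 0"
    and expansion: "\<And>y. y \<in> {v, 2 * v, 4 * v} \<Longrightarrow>
      (\<lambda>z. (Q y z - Q 1 z) / p z - box_cox (g z) y) \<in> o[F](l)"
    and expansion': "\<And>y. y \<in> {v, 2 * v, 4 * v} \<Longrightarrow>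
      (\<lambda>z. (Q' y z - Q' 1 z) / q z - box_cox (g' z) y) \<in> o[F](l)"
    and close: "\<And>y. y \<in> {v, 2 * v, 4 * v} \<Longrightarrow>
      (\<lambda>z. (Q y z - Q' y z) / q z) \<in> o[F](\<lambda>z. l z * (p z / q z + 1))"
  shows "(\<lambda>z. g z - g' z) \<in> o[F](l)"
    and "(\<lambda>z. p z / q z - 1) \<in> o[F](l)"
    and "(\<lambda>z. (Q 1 z - Q' 1 z) / q z) \<in> o[F](l)"
proof -
  define r where "r z = p z / q z" for z
  define D where "D z = box_cox (g z) (2 * v) - box_cox (g z) v" for z
  define D' where "D' z = box_cox (g' z) (2 * v) - box_cox (g' z) v" for z
  obtain c C where "0 < c" and cC: "\<And>g x y. \<bar>g\<bar> \<le> G \<Longrightarrow> v \<le> x \<Longrightarrow> x \<le> y \<Longrightarrow> y \<le> 4 * v \<Longrightarrow>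
       c * (y - x) \<le> box_cox g y - box_cox g x \<and> box_cox g y - box_cox g x \<le> C * (y - x)"
    using that by (rule box_cox_increment_bounds[OF v, of G "4 * v"])
  define d where "d = c * v"
  define d' where "d' = C * v"
  have "d > 0"
    using v \<open>0 < c\<close> by (simp add: d_def)
  have D_bounds: "\<forall>\<^sub>F z in F. d \<le> D z \<and> D z \<le> d' \<and> d \<le> D' z \<and> D' z \<le> d'"
    using g
  proof eventually_elim
    case (elim z)
    then show ?case
      using cC[of "g z" v "2 * v"] cC[of "g' z" v "2 * v"] v
      by (simp add: D_def D'_def d_def d'_def)
  qed
  have g_O1: "h \<in> O[F](\<lambda>_. 1)" if "\<forall>\<^sub>F z in F. \<bar>h z\<bar> \<le> K" for h :: "'z \<Rightarrow> real" and K
    using that by (intro bigoI[of _ K]) simp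

  have increment_close:
    "(\<lambda>z. r z * ((Q y z - Q x z) / p z) - (Q' y z - Q' x z) / q z) \<in> o[F](\<lambda>z. l z * (r z + 1))"
    if "x \<in> {v, 2 * v, 4 * v}" "y \<in> {v, 2 * v, 4 * v}" for x y
  proof -
    have "(\<lambda>z. (Q y z - Q' y z) / q z - (Q x z - Q' x z) / q z) \<in> o[F](\<lambda>z. l z * (r z + 1))"
      unfolding r_def using that by (intro sum_in_smallo close)
    moreover have "\<forall>\<^sub>F z in F. (Q y z - Q' y z) / q z - (Q x z - Q' x z) / q z
        = r z * ((Q y z - Q x z) / p z) - (Q' y z - Q' x z) / q z"
      using pos by eventually_elim (simp add: r_def field_simps)
    ultimately show ?thesis
      by (rule smallo_eventually_eq)
  qed
  have increment_expansion:
    "(\<lambda>z. (Q y z - Q x z) / p z - (box_cox (g z) y - box_cox (g z) x)) \<in> o[F](l)"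
    "(\<lambda>z. (Q' y z - Q' x z) / q z - (box_cox (g' z) y - box_cox (g' z) x)) \<in> o[F](l)"
    if "x \<in> {v, 2 * v, 4 * v}" "y \<in> {v, 2 * v, 4 * v}" for x y
    using sum_in_smallo(2)[OF expansion[OF that(2)] expansion[OF that(1)]]
      sum_in_smallo(2)[OF expansion'[OF that(2)] expansion'[OF that(1)]]
    by (simp_all add: diff_divide_distrib algebra_simps)

  have small: "\<forall>\<^sub>F z in F. \<bar>f z\<bar> \<le> e" if "f \<in> o[F](l)" "e > 0" for f e
    using landau_o.smallD[OF landau_o.small_big_trans[OF that(1) l] that(2)] by simp
  \<comment> \<open>Absorption argument: the rescaled increment \<open>?A\<close> is at least
    \<open>d / 2\<close>, whereas the error grows in \<open>r\<close> only with slope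
    \<open>d / 4\<close>. The remaining \<open>r * (d / 4)\<close> is bounded by
    \<open>d' + d\<close>.\<close>
  have r_O1: "r \<in> O[F](\<lambda>_. 1)"
  proof (rule g_O1)
    let ?A = "\<lambda>z. (Q (2 * v) z - Q v z) / p z" and ?A' = "\<lambda>z. (Q' (2 * v) z - Q' v z) / q z"
    have "(\<lambda>z. l z * (r z + 1)) \<in> O[F](\<lambda>z. 1 * (r z + 1))"
      using l by (intro landau_o.big.mult) auto
    then have "(\<lambda>z. r z * ?A z - ?A' z) \<in> o[F](\<lambda>z. 1 * (r z + 1))"
      using increment_close by (rule landau_o.small_big_trans[rotated]) auto
    from landau_o.smallD[OF this, of "d / 4"]
    have 1: "\<forall>\<^sub>F z in F. \<bar>r z * ?A z - ?A' z\<bar> \<le> d / 4 * \<bar>r z + 1\<bar>"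
      using \<open>d > 0\<close> by simp
    have 2: "\<forall>\<^sub>F z in F. \<bar>?A z - D z\<bar> \<le> d / 2"
      unfolding D_def using \<open>d > 0\<close> by (intro small increment_expansion) auto
    have 3: "\<forall>\<^sub>F z in F. \<bar>?A' z - D' z\<bar> \<le> d / 2"
      unfolding D'_def using \<open>d > 0\<close> by (intro small increment_expansion) auto
    show "\<forall>\<^sub>F z in F. \<bar>r z\<bar> \<le> (d' + d) * (4 / d)"
      using 1 2 3 pos D_bounds
    proof eventually_elim
      case (elim z)
      have "r z > 0"
        using elim by (simp add: r_def)
      have "d / 2 \<le> ?A z"
        using elim by linarith
      then have "r z * (d / 2) \<le> r z * ?A z"
        using \<open>r z > 0\<close> by (intro mult_left_mono) auto
      moreover have "\<bar>r z + 1\<bar> = r z + 1"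
        using \<open>r z > 0\<close> by simp
      then have "d / 4 * \<bar>r z + 1\<bar> = r z * (d / 4) + d / 4"
        by (simp add: algebra_simps)
      moreover have "r z * (d / 2) = 2 * (r z * (d / 4))"
        by simp
      ultimately have "r z * (d / 4) \<le> d' + d"
        using elim \<open>d > 0\<close> by linarith
      then show ?case
        using \<open>r z > 0\<close> \<open>d > 0\<close> by (simp add: field_simps)
    qed
  qed
  then have "(\<lambda>z. r z + 1) \<in> O[F](\<lambda>_. 1)"
    by (rule sum_in_bigo(1)) simp
  from landau_o.big.mult[OF landau_o.big_refl this, of l]
  have lr: "(\<lambda>z. l z * (r z + 1)) \<in> O[F](l)"
    by (simp only: mult_1_right)
  have ratio: "(\<lambda>z. r z * (box_cox (g z) y - box_cox (g z) x) - (box_cox (g' z) y - box_cox (g' z) x))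
      \<in> o[F](l)"
    if "x \<in> {v, 2 * v, 4 * v}" "y \<in> {v, 2 * v, 4 * v}" for x y
  proof -
    let ?A = "\<lambda>z. (Q y z - Q x z) / p z" and ?A' = "\<lambda>z. (Q' y z - Q' x z) / q z"
    have "(\<lambda>z. (r z * ?A z - ?A' z) - r z * (?A z - (box_cox (g z) y - box_cox (g z) x))
        + (?A' z - (box_cox (g' z) y - box_cox (g' z) x))) \<in> o[F](l)"
      using landau_o.small_big_trans[OF increment_close[OF that] lr] increment_expansion[OF that] r_O1
      by - (assumption | rule sum_in_smallo smallo_mult_bounded)+
    then show ?thesis
      by (simp add: algebra_simps)
  qed
  have D_ratio: "(\<lambda>z. r z * D z - D' z) \<in> o[F](l)"
    unfolding D_def D'_def by (rule ratio) auto
  have E_ratio: "(\<lambda>z. r z * (2 powr g z * D z) - 2 powr g' z * D' z) \<in> o[F](l)"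
    using ratio[of "2 * v" "4 * v"] v by (simp add: D_def D'_def box_cox_geometric)

  have inverse_O1: "(\<lambda>z. inverse (D z)) \<in> O[F](\<lambda>_. 1)" "(\<lambda>z. inverse (D' z)) \<in> O[F](\<lambda>_. 1)"
    using D_bounds \<open>d > 0\<close>
    by (auto intro!: g_O1[of _ "inverse d"] le_imp_inverse_le elim: eventually_mono)
  have "\<forall>\<^sub>F z in F. \<bar>2 powr g z\<bar> \<le> 2 powr G"
    using g by eventually_elim (simp add: abs_le_iff)
  then have two_O1: "(\<lambda>z. 2 powr g z) \<in> O[F](\<lambda>_. 1)"
    by (rule g_O1)
  \<comment> \<open>Subtracting \<open>2 powr g\<close> times the relation for the first increment
    eliminates the unknown ratio \<open>r\<close>.\<close>
  have "(\<lambda>z. (r z * (2 powr g z * D z) - 2 powr g' z * D' z) - 2 powr g z * (r z * D z - D' z))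
      \<in> o[F](l)"
    using E_ratio D_ratio two_O1 by - (assumption | rule sum_in_smallo smallo_mult_bounded)+
  then have "(\<lambda>z. (2 powr g z - 2 powr g' z) * D' z) \<in> o[F](l)"
    by (simp add: algebra_simps)
  then have *: "(\<lambda>z. inverse (D' z) * ((2 powr g z - 2 powr g' z) * D' z)) \<in> o[F](l)"
    using inverse_O1(2) by (rule smallo_mult_bounded)
  obtain K where K: "\<And>g g'. \<bar>g\<bar> \<le> G \<Longrightarrow> \<bar>g'\<bar> \<le> G \<Longrightarrow> \<bar>g - g'\<bar> \<le> K * \<bar>2 powr g - 2 powr g'\<bar>"
    using that by (rule two_powr_inverse_lipschitz[of G])
  have "(\<lambda>z. g z - g' z) \<in> O[F](\<lambda>z. inverse (D' z) * ((2 powr g z - 2 powr g' z) * D' z))"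
  proof (rule bigoI)
    show "\<forall>\<^sub>F z in F. norm (g z - g' z)
        \<le> K * norm (inverse (D' z) * ((2 powr g z - 2 powr g' z) * D' z))"
      using g D_bounds
    proof eventually_elim
      case (elim z)
      then have eq: "inverse (D' z) * ((2 powr g z - 2 powr g' z) * D' z) = 2 powr g z - 2 powr g' z"
        using \<open>d > 0\<close> by (simp add: field_simps)
      show ?case
        unfolding eq using K elim by simp
    qed
  qed
  then show g_small: "(\<lambda>z. g z - g' z) \<in> o[F](l)"
    using * by (rule landau_o.big_small_trans)

  obtain K where K: "\<And>g g' y. \<bar>g\<bar> \<le> G \<Longrightarrow> \<bar>g'\<bar> \<le> G \<Longrightarrow> v \<le> y \<Longrightarrow> y \<le> 2 * v \<Longrightarrow>
    \<bar>box_cox g y - box_cox g' y\<bar> \<le> K * \<bar>g - g'\<bar>"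
    using that by (rule box_cox_lipschitz_index[OF v, of G "2 * v"])
  have B_diff: "(\<lambda>z. box_cox (g z) y - box_cox (g' z) y) \<in> o[F](l)" if "v \<le> y" "y \<le> 2 * v" for y
  proof (rule landau_o.big_small_trans[OF _ g_small])
    show "(\<lambda>z. box_cox (g z) y - box_cox (g' z) y) \<in> O[F](\<lambda>z. g z - g' z)"
      using g that K by (intro bigoI[of _ K]) (auto elim!: eventually_mono)
  qed
  have "(\<lambda>z. (box_cox (g z) (2 * v) - box_cox (g' z) (2 * v)) - (box_cox (g z) v - box_cox (g' z) v))
      \<in> o[F](l)"
    using v by (intro sum_in_smallo B_diff) auto
  then have "(\<lambda>z. D z - D' z) \<in> o[F](l)"
    by (simp add: D_def D'_def algebra_simps)
  \<comment> \<open>Since \<open>D\<close> and \<open>D'\<close> are now close, the two differences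
    combine to \<open>(r - 1) * D\<close>.\<close>
  then have "(\<lambda>z. inverse (D z) * ((r z * D z - D' z) - (D z - D' z))) \<in> o[F](l)"
    using D_ratio inverse_O1(1) by - (assumption | rule sum_in_smallo smallo_mult_bounded)+
  moreover have "\<forall>\<^sub>F z in F. inverse (D z) * ((r z * D z - D' z) - (D z - D' z)) = r z - 1"
    using D_bounds
  proof eventually_elim
    case (elim z)
    then have "D z \<noteq> 0"
      using \<open>d > 0\<close> by auto
    then show ?case
      by (simp add: field_simps)
  qed
  ultimately have r_small: "(\<lambda>z. r z - 1) \<in> o[F](l)"
    by (rule smallo_eventually_eq)
  then show "(\<lambda>z. p z / q z - 1) \<in> o[F](l)"
    by (simp add: r_def)

  obtain K' where K': "\<And>g y. \<bar>g\<bar> \<le> G \<Longrightarrow> v \<le> y \<Longrightarrow> y \<le> v \<Longrightarrow> \<bar>box_cox g y\<bar> \<le> K'"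
    using that by (rule box_cox_bounded[OF v, of G v])
  have "\<forall>\<^sub>F z in F. \<bar>box_cox (g z) v\<bar> \<le> K'"
    using g K' by (auto elim: eventually_mono)
  then have B_O1: "(\<lambda>z. box_cox (g z) v) \<in> O[F](\<lambda>_. 1)"
    by (rule g_O1)
  have v_mem: "v \<in> {v, 2 * v, 4 * v}"
    by simp
  have B_v: "(\<lambda>z. box_cox (g z) v - box_cox (g' z) v) \<in> o[F](l)"
    using v by (intro B_diff) auto
  have "(\<lambda>z. (Q v z - Q' v z) / q z) \<in> o[F](l)"
    using close[OF v_mem] lr unfolding r_def by (rule landau_o.small_big_trans)
  \<comment> \<open>The difference at 1 is reached from the one at \<open>v\<close> by subtracting
    the expansion of \<open>Q\<close>, rescaled by \<open>r\<close>, and adding that of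
    \<open>Q'\<close>. The last two terms cancel what the change of scale and index leaves
    over.\<close>
  then have "(\<lambda>z. (Q v z - Q' v z) / q z - r z * ((Q v z - Q 1 z) / p z - box_cox (g z) v)
      + ((Q' v z - Q' 1 z) / q z - box_cox (g' z) v) - box_cox (g z) v * (r z - 1)
      - (box_cox (g z) v - box_cox (g' z) v)) \<in> o[F](l)"
    using expansion[OF v_mem] expansion'[OF v_mem] B_v r_small r_O1 B_O1
    by - (assumption | rule sum_in_smallo smallo_mult_bounded)+
  moreover have "\<forall>\<^sub>F z in F. (Q v z - Q' v z) / q z - r z * ((Q v z - Q 1 z) / p z - box_cox (g z) v)
      + ((Q' v z - Q' 1 z) / q z - box_cox (g' z) v) - box_cox (g z) v * (r z - 1)
      - (box_cox (g z) v - box_cox (g' z) v) = (Q 1 z - Q' 1 z) / q z"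
    using pos by eventually_elim (simp add: r_def field_simps)
  ultimately show "(\<lambda>z. (Q 1 z - Q' 1 z) / q z) \<in> o[F](l)"
    by (rule smallo_eventually_eq)
qed

text \<open>Location, scale and index are exchanged one at a time, each at a cost of
  o(\<open>l\<close>). The argument \<open>y\<close> may vary with \<open>z\<close> inside a compact
  interval, which yields uniformity in \<open>y\<close>.\<close>

lemma quantile_expansion_shift:
  fixes F :: "'z filter" and p q g g' l y :: "'z \<Rightarrow> real" and Q Q\<^sub>1 Q\<^sub>1' :: "'z \<Rightarrow> real" and G y\<^sub>0 y\<^sub>1 :: real
  assumes pos: "\<forall>\<^sub>F z in F. p z > 0 \<and> q z > 0"
    and g: "\<forall>\<^sub>F z in F. \<bar>g z\<bar> \<le> G \<and> \<bar>g' z\<bar> \<le> G"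
    and y: "0 < y\<^sub>0" "\<forall>\<^sub>F z in F. y\<^sub>0 \<le> y z \<and> y z \<le> y\<^sub>1"
    and l: "l \<in> O[F](\<lambda>_. 1)"
    and expansion: "(\<lambda>z. (Q z - Q\<^sub>1 z) / p z - box_cox (g z) (y z)) \<in> o[F](l)"
    and g_close: "(\<lambda>z. g z - g' z) \<in> o[F](l)"
    and ratio: "(\<lambda>z. p z / q z - 1) \<in> o[F](l)"
    and Q_close: "(\<lambda>z. (Q\<^sub>1 z - Q\<^sub>1' z) / q z) \<in> o[F](l)"
  shows "(\<lambda>z. (Q z - Q\<^sub>1' z) / q z - box_cox (g' z) (y z)) \<in> o[F](l)"
proof -
  obtain K where K: "\<And>g g' y. \<bar>g\<bar> \<le> G \<Longrightarrow> \<bar>g'\<bar> \<le> G \<Longrightarrow> y\<^sub>0 \<le> y \<Longrightarrow> y \<le> y\<^sub>1 \<Longrightarrow>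
    \<bar>box_cox g y - box_cox g' y\<bar> \<le> K * \<bar>g - g'\<bar>"
    using that by (rule box_cox_lipschitz_index[OF y(1), of G y\<^sub>1])
  have "(\<lambda>z. box_cox (g z) (y z) - box_cox (g' z) (y z)) \<in> O[F](\<lambda>z. g z - g' z)"
    using eventually_conj[OF g y(2)] K by (intro bigoI[of _ K]) (auto elim!: eventually_mono)
  then have B_diff: "(\<lambda>z. box_cox (g z) (y z) - box_cox (g' z) (y z)) \<in> o[F](l)"
    using g_close by (rule landau_o.big_small_trans)
  obtain K' where K': "\<And>g y. \<bar>g\<bar> \<le> G \<Longrightarrow> y\<^sub>0 \<le> y \<Longrightarrow> y \<le> y\<^sub>1 \<Longrightarrow> \<bar>box_cox g y\<bar> \<le> K'"
    using that by (rule box_cox_bounded[OF y(1), of G y\<^sub>1])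
  have B_O1: "(\<lambda>z. box_cox (g z) (y z)) \<in> O[F](\<lambda>_. 1)"
    using eventually_conj[OF g y(2)] K' by (intro bigoI[of _ K']) (auto elim!: eventually_mono)
  have "(\<lambda>z. p z / q z - 1 + 1) \<in> O[F](\<lambda>_. 1)"
    using landau_o.big_trans[OF landau_o.small_imp_big[OF ratio] l] by (rule sum_in_bigo(1)) simp
  then have r_O1: "(\<lambda>z. p z / q z) \<in> O[F](\<lambda>_. 1)"
    by (simp only: diff_add_cancel)
  have "(\<lambda>z. (Q\<^sub>1 z - Q\<^sub>1' z) / q z + p z / q z * ((Q z - Q\<^sub>1 z) / p z - box_cox (g z) (y z))
      + box_cox (g z) (y z) * (p z / q z - 1) + (box_cox (g z) (y z) - box_cox (g' z) (y z))) \<in> o[F](l)"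
    using Q_close expansion ratio B_diff r_O1 B_O1
    by - (assumption | rule sum_in_smallo smallo_mult_bounded)+
  moreover have "\<forall>\<^sub>F z in F. (Q\<^sub>1 z - Q\<^sub>1' z) / q z
      + p z / q z * ((Q z - Q\<^sub>1 z) / p z - box_cox (g z) (y z))
      + box_cox (g z) (y z) * (p z / q z - 1) + (box_cox (g z) (y z) - box_cox (g' z) (y z))
      = (Q z - Q\<^sub>1' z) / q z - box_cox (g' z) (y z)"
    using pos by eventually_elim (simp add: field_simps)
  ultimately show ?thesis
    by (rule smallo_eventually_eq)
qed

theorem theorem2p4:
  fixes M :: "'a measure" and N :: "'b measure"
    and X :: "nat \<Rightarrow> real \<Rightarrow> 'a \<Rightarrow> real" and Y :: "real \<Rightarrow> 'b \<Rightarrow> real"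
    and a U :: "real \<Rightarrow> real \<Rightarrow> real" and \<gamma> :: "real \<Rightarrow> real"
    and k :: "nat \<Rightarrow> nat" and T :: "nat \<Rightarrow> nat \<Rightarrow> real" and J :: "nat \<Rightarrow> nat"
    and lam :: "nat \<Rightarrow> real" and h :: "real \<Rightarrow> real" and \<kappa> :: real
  defines "U \<equiv> tail_quantile M (X 1)"
  assumes iid: "iid_continuous_processes M X"
    and a_pos: "\<And>t u. t \<in> {0..1} \<Longrightarrow> u > 0 \<Longrightarrow> a t u > 0"
    and conv: "weakly_converges_C01 M (normalized_max X a U) N Y"
    and max_stable: "max_stable_process N Y"
    and margins: "\<And>t y. t \<in> {0..1} \<Longrightarrow> 1 + \<gamma> t * y > 0 \<Longrightarrow>
        measure N {\<omega> \<in> space N. Y t \<omega> \<le> y} = gev_cdf (\<gamma> t) y"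
    and \<gamma>_cont: "continuous_on {0..1} \<gamma>"
    and k: "intermediate_sequence k"
    and grid: "is_grid T J"
    and mesh: "mesh T J \<longlonglongrightarrow> 0"
    and lam_pos: "\<And>n. n \<ge> 1 \<Longrightarrow> lam n > 0"
    and lam_bdd: "bounded (lam ` {1..})"
    and h_rv: "regularly_varying h \<kappa>"
    and \<kappa>: "\<kappa> \<in> {0<..1}"
    and h_eq: "\<And>n. n \<ge> 1 \<Longrightarrow> real n / real (k n) = h (real n)"
    and k_slow: "(\<lambda>n. real (k (n - 1)) / real (k n) - 1) \<in> o(lam)"
    and lam_reg: "\<And>c\<^sub>0. c\<^sub>0 \<in> {0<..1} \<Longrightarrow>
        (\<lambda>n. SUP c\<in>{c\<^sub>0..1}. lam (nat \<lfloor>c * real n\<rfloor>) / lam n) \<in> O(\<lambda>_. 1)"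
    and cond_M: "\<And>y\<^sub>0 y\<^sub>1. 0 < y\<^sub>0 \<Longrightarrow> y\<^sub>0 < y\<^sub>1 \<Longrightarrow>
        sup_smallo (\<lambda>n. {0..1} \<times> {y\<^sub>0..y\<^sub>1})
          (\<lambda>n (t, y). (U t (y * real n / real (k n)) - U t (real n / real (k n)))
              / a t (real n / real (k n)) - box_cox (\<gamma> t) y)
          lam"
    and cond_S: "\<exists>\<tau>. ereal \<tau> < tau_max \<gamma> \<and> (\<forall>\<epsilon>>0.
        sup_smallo (\<lambda>n. close_pairs (mesh T J n))
          (\<lambda>n (s, t). measure M {\<omega> \<in> space M.
              \<bar>X 1 s \<omega> - X 1 t \<omega>\<bar> / a t (real n / real (k n)) > \<epsilon> * lam n \<and>
              X 1 t \<omega> > U t (real n / real (k n)) + \<tau> * a t (real n / real (k n))})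
          (\<lambda>n. lam n * real (k n) / real n))"
  shows "(\<forall>y\<^sub>0 y\<^sub>1. 0 < y\<^sub>0 \<and> y\<^sub>0 < y\<^sub>1 \<longrightarrow>
            sup_smallo (\<lambda>n. close_pairs (mesh T J n) \<times> {y\<^sub>0..y\<^sub>1})
              (\<lambda>n ((s, t), y). (U s (y * real n / real (k n)) - U t (real n / real (k n)))
                  / a t (real n / real (k n)) - box_cox (\<gamma> t) y)
              lam)
       \<and> sup_smallo (\<lambda>n. close_pairs (mesh T J n)) (\<lambda>n (s, t). \<gamma> s - \<gamma> t) lam
       \<and> sup_smallo (\<lambda>n. close_pairs (mesh T J n))
            (\<lambda>n (s, t). a s (real n / real (k n)) / a t (real n / real (k n)) - 1) lam
       \<and> sup_smallo (\<lambda>n. close_pairs (mesh T J n))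
            (\<lambda>n (s, t). (U s (real n / real (k n)) - U t (real n / real (k n)))
                / a t (real n / real (k n))) lam"
proof -

  \<comment> \<open>Levels, positivity and boundedness\<close>
  let ?P = "\<lambda>n. close_pairs (mesh T J n)"
  let ?F = "uniformly_in ?P"
  define u where "u n = real n / real (k n)" for n
  have M: "prob_space M" and X: "\<And>t. t \<in> {0..1} \<Longrightarrow> X 1 t \<in> borel_measurable M"
    using iid by (auto simp: iid_continuous_processes_def continuous_process_def)
  have smallo_iff: "sup_smallo S f lam \<longleftrightarrow>
      (\<lambda>z. f (fst z) (snd z)) \<in> o[uniformly_in S](\<lambda>z. lam (fst z))" for S and f :: "nat \<Rightarrow> 'i \<Rightarrow> real"
    using lam_pos by (rule sup_smallo_iff_smallo)
  have pairs: "(s, t) \<in> ?P n \<Longrightarrow> s \<in> {0..1} \<and> t \<in> {0..1} \<and> (t, s) \<in> ?P n" for s t n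
    by (auto simp: close_pairs_def abs_minus_commute)
  have u_pos: "u n > 0" if "n \<ge> 1" for n
    using k that by (force simp: u_def intermediate_sequence_def)
  have "\<forall>\<^sub>F n in sequentially. real (k n) / real n < 1"
    using k by (intro order_tendstoD(2)[of _ 0]) (auto simp: intermediate_sequence_def)
  with eventually_ge_at_top[of 1] have u_gt_1: "\<forall>\<^sub>F n in sequentially. u n > 1"
  proof eventually_elim
    case (elim n)
    \<comment> \<open>Division by zero yields 0, so positivity of \<open>u n\<close> excludes
      \<open>k n = 0\<close>.\<close>
    then have "k n \<noteq> 0"
      using u_pos[of n] by (intro notI) (simp add: u_def)
    then show ?case
      using elim by (simp add: u_def)
  qed
  obtain \<Lambda> where \<Lambda>: "\<And>n. n \<ge> 1 \<Longrightarrow> lam n \<le> \<Lambda>" "\<Lambda> > 0"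
  proof -
    obtain B where "\<And>n. n \<ge> 1 \<Longrightarrow> \<bar>lam n\<bar> \<le> B"
      using lam_bdd by (auto simp: bounded_iff)
    then have "lam n \<le> B" if "n \<ge> 1" for n
      using that by (meson abs_le_D1)
    moreover have "B > 0"
      using lam_pos[of 1] calculation[of 1] by simp
    ultimately show ?thesis
      by (rule that)
  qed
  obtain t\<^sub>0 where t\<^sub>0: "t\<^sub>0 \<in> {0..1}" "\<And>t. t \<in> {0..1} \<Longrightarrow> \<gamma> t\<^sub>0 \<le> \<gamma> t"
    using continuous_attains_inf[OF compact_Icc _ \<gamma>_cont] by auto
  have "bounded (\<gamma> ` {0..1})"
    by (intro compact_imp_bounded compact_continuous_image \<gamma>_cont compact_Icc)
  then obtain G where "\<forall>x\<in>\<gamma> ` {0..1}. norm x \<le> G"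
    unfolding bounded_iff by blast
  then have G: "\<And>t. t \<in> {0..1} \<Longrightarrow> \<bar>\<gamma> t\<bar> \<le> G"
    by simp

  \<comment> \<open>The threshold for condition (S)\<close>
  obtain \<tau> where \<tau>: "ereal \<tau> < tau_max \<gamma>" and S: "\<And>\<epsilon>. \<epsilon> > 0 \<Longrightarrow>
      sup_smallo ?P
        (\<lambda>n (s, t). measure M {\<omega> \<in> space M.
            \<bar>X 1 s \<omega> - X 1 t \<omega>\<bar> / a t (real n / real (k n)) > \<epsilon> * lam n \<and>
            X 1 t \<omega> > U t (real n / real (k n)) + \<tau> * a t (real n / real (k n))})
        (\<lambda>n. lam n * real (k n) / real n)"
    using cond_S by blast
  \<comment> \<open>The point \<open>w\<close> is chosen for the smallest index
    \<open>\<gamma> t\<^sub>0\<close>; monotonicity in the index makes it work for every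
    \<open>t\<close>.\<close>
  have "\<gamma> t\<^sub>0 < 0 \<longrightarrow> \<tau> < - 1 / \<gamma> t\<^sub>0"
  proof
    assume "\<gamma> t\<^sub>0 < 0"
    have "ereal \<tau> < 1 / ereal (max (- \<gamma> t\<^sub>0) 0)"
      using \<tau> t\<^sub>0(1) unfolding tau_max_def by (rule less_INF_D)
    then show "\<tau> < - 1 / \<gamma> t\<^sub>0"
      using \<open>\<gamma> t\<^sub>0 < 0\<close> by (simp add: one_ereal_def)
  qed
  then obtain w where w: "1 \<le> w" "\<tau> < box_cox (\<gamma> t\<^sub>0) w"
    by (rule box_cox_exceeds)
  \<comment> \<open>The margin \<open>\<eta>\<close> will absorb the error of (M) at
    \<open>w\<close>.\<close>
  define \<eta> where "\<eta> = box_cox (\<gamma> t\<^sub>0) w - \<tau>"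
  have "\<eta> > 0"
    using w by (simp add: \<eta>_def)
  have threshold: "\<tau> + \<eta> \<le> box_cox (\<gamma> t) w" if "t \<in> {0..1}" for t
    using box_cox_mono_index[OF w(1) t\<^sub>0(2)[OF that]] by (simp add: \<eta>_def)

  \<comment> \<open>One-sided comparison of quantiles\<close>
  have gap: "\<forall>\<^sub>F n in sequentially. \<forall>(s, t)\<in>?P n.
      U t (y * u n) - U s (y * u n) \<le> e * lam n * a t (u n)"
    if "e > 0" and y: "y \<ge> 2 * w" for e y
  proof -
    have "w > 0" "y > 0"
      using w y by auto
    obtain c' C where "0 < c'" and cC: "\<And>g x z. \<bar>g\<bar> \<le> G \<Longrightarrow> w \<le> x \<Longrightarrow> x \<le> z \<Longrightarrow> z \<le> y \<Longrightarrow>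
       c' * (z - x) \<le> box_cox g z - box_cox g x \<and> box_cox g z - box_cox g x \<le> C * (z - x)"
      using that by (rule box_cox_increment_bounds[OF \<open>w > 0\<close>, of G y])
    define K where "K = \<bar>C\<bar>"
    \<comment> \<open>The budget \<open>e\<close> is spent as \<open>e / 4\<close> on the
      oscillation, at most \<open>e / 2\<close> on the two uses of (M), and at most
      \<open>e / 4\<close> on the shift of level. The other bounds in the minima give
      \<open>m * \<Lambda> < \<eta>\<close> and \<open>y * (c * \<Lambda>) \<le> 1\<close>. Writing
      \<open>K + 1\<close> keeps the denominator positive if \<open>K = 0\<close>.\<close>
    define m where "m = min (e / 4) (\<eta> / (2 * \<Lambda>))"
    define c where "c = min (1 / (y * \<Lambda>)) (e / (4 * (K + 1) * y\<^sup>2))"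
    have m: "0 < m" "m \<le> e / 4" "m * \<Lambda> < \<eta>"
    proof -
      show "0 < m" "m \<le> e / 4"
        using \<open>e > 0\<close> \<open>\<eta> > 0\<close> \<Lambda>(2) by (auto simp: m_def)
      have "m * \<Lambda> \<le> \<eta> / (2 * \<Lambda>) * \<Lambda>"
        using \<Lambda>(2) by (intro mult_right_mono) (auto simp: m_def)
      also have "\<dots> < \<eta>"
        using \<Lambda>(2) \<open>\<eta> > 0\<close> by simp
      finally show "m * \<Lambda> < \<eta>" .
    qed
    have c: "0 < c" "y * (c * \<Lambda>) \<le> 1" "K * y\<^sup>2 * c \<le> e / 4"
    proof -
      have K: "K \<ge> 0"
        by (simp add: K_def)
      then show "0 < c"
        using \<open>e > 0\<close> \<Lambda>(2) \<open>y > 0\<close> by (auto simp: c_def)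
      have "y * \<Lambda> * c \<le> y * \<Lambda> * (1 / (y * \<Lambda>))"
        using \<Lambda>(2) \<open>y > 0\<close> by (intro mult_left_mono) (auto simp: c_def)
      then show "y * (c * \<Lambda>) \<le> 1"
        using \<Lambda>(2) \<open>y > 0\<close> by (simp add: mult_ac)
      have "K * y\<^sup>2 * c \<le> (K + 1) * y\<^sup>2 * (e / (4 * (K + 1) * y\<^sup>2))"
        using K \<open>y > 0\<close> \<open>0 < c\<close> by (intro mult_mono) (auto simp: c_def)
      also have "\<dots> = e / 4"
      proof -
        have "x * (e / (4 * x)) = e / 4" if "x \<noteq> 0" for x
          using that by simp
        moreover have "(K + 1) * y\<^sup>2 \<noteq> 0"
          using K \<open>y > 0\<close> by auto
        ultimately have "(K + 1) * y\<^sup>2 * (e / (4 * ((K + 1) * y\<^sup>2))) = e / 4"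
          by blast
        then show ?thesis
          by (simp only: mult.assoc[of 4])
      qed
      finally show "K * y\<^sup>2 * c \<le> e / 4" .
    qed
    have "w < y"
      using w y by simp
    from sup_smallo_eventually[OF cond_M[OF \<open>w > 0\<close> this] \<open>m > 0\<close>]
    have 1: "\<forall>\<^sub>F n in sequentially. \<forall>t\<in>{0..1}. \<forall>x\<in>{w..y}.
        \<bar>(U t (x * u n) - U t (u n)) / a t (u n) - box_cox (\<gamma> t) x\<bar> \<le> m * lam n"
      by (simp add: u_def)
    have "e / 4 > 0"
      using \<open>e > 0\<close> by simp
    from sup_smallo_eventually[OF S[OF this] \<open>c > 0\<close>]
    have 2: "\<forall>\<^sub>F n in sequentially. \<forall>(s, t)\<in>?P n. measure M {\<omega> \<in> space M.
            \<bar>X 1 s \<omega> - X 1 t \<omega>\<bar> / a t (u n) > e / 4 * lam n \<and>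
            X 1 t \<omega> > U t (u n) + \<tau> * a t (u n)} \<le> c * lam n / u n"
      by (simp add: u_def case_prod_unfold mult.assoc)
    show ?thesis
      using 1 2 u_gt_1 eventually_ge_at_top[of 1]
    proof eventually_elim
      case (elim n)
      have l: "0 < lam n" "lam n \<le> \<Lambda>"
        using elim lam_pos \<Lambda> by auto
      have "U t (y * u n) - U s (y * u n) \<le> e * lam n * a t (u n)" if st: "(s, t) \<in> ?P n" for s t
      proof -
        have s: "s \<in> {0..1}" and t: "t \<in> {0..1}"
          using pairs[OF st] by auto
        have a: "0 < a t (u n)"
          using t elim by (intro a_pos) auto
        have "m * lam n \<le> m * \<Lambda>" "y * (c * lam n) \<le> y * (c * \<Lambda>)"
          using l m c \<open>y > 0\<close> by (auto intro!: mult_left_mono)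
        then have small: "\<tau> + m * lam n < box_cox (\<gamma> t) w" "y * (c * lam n) \<le> 1"
          using threshold[OF t] m(3) c(2) by linarith+
        have incr: "box_cox (\<gamma> t) y - box_cox (\<gamma> t) x \<le> K * (y - x)" if "x \<in> {w..y}" for x
        proof -
          have "C * (y - x) \<le> K * (y - x)"
            using that by (intro mult_right_mono) (auto simp: K_def)
          then show ?thesis
            using cC[OF G[OF t], of x y] that by auto
        qed
        have "U t (y * u n) - U s (y * u n) \<le> (e / 4 + 2 * m + K * y\<^sup>2 * c) * lam n * a t (u n)"
          unfolding U_def
        proof (rule tail_quantile_gap[OF M X[OF s] X[OF t] a _ w(1) y _ _ _ small(2) _ _ small(1) incr])
          show "\<bar>(tail_quantile M (X 1) t (x * u n) - tail_quantile M (X 1) t (u n)) / a t (u n)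
              - box_cox (\<gamma> t) x\<bar> \<le> m * lam n" if "x \<in> {w..y}" for x
            using elim(1) t that by (simp add: U_def)
          show "measure M {\<omega> \<in> space M. \<bar>X 1 s \<omega> - X 1 t \<omega>\<bar> / a t (u n) > e / 4 * lam n \<and>
              X 1 t \<omega> > tail_quantile M (X 1) t (u n) + \<tau> * a t (u n)} \<le> c * lam n / u n"
            using elim(2) st by (auto simp: U_def)
        qed (use l c elim in \<open>auto simp: K_def\<close>)
        also have "\<dots> \<le> e * lam n * a t (u n)"
          using l a m c by (intro mult_right_mono) auto
        finally show ?thesis .
      qed
      then show ?case
        by blast
    qed
  qed

  \<comment> \<open>Two-sided closeness of quantiles\<close>
  have close: "(\<lambda>z. (U (fst (snd z)) (y * u (fst z)) - U (snd (snd z)) (y * u (fst z)))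
        / a (snd (snd z)) (u (fst z))) \<in>
      o[?F](\<lambda>z. lam (fst z) * (a (fst (snd z)) (u (fst z)) / a (snd (snd z)) (u (fst z)) + 1))"
    if "y \<ge> 2 * w" for y
  proof (rule landau_o.smallI)
    fix e :: real
    assume "e > 0"
    show "\<forall>\<^sub>F z in ?F. norm ((U (fst (snd z)) (y * u (fst z)) - U (snd (snd z)) (y * u (fst z)))
        / a (snd (snd z)) (u (fst z))) \<le> e * norm (lam (fst z) *
          (a (fst (snd z)) (u (fst z)) / a (snd (snd z)) (u (fst z)) + 1))"
      unfolding eventually_uniformly_in
      using gap[OF \<open>e > 0\<close> that] eventually_ge_at_top[of 1]
    proof eventually_elim
      case (elim n)
      have "\<bar>(U s (y * u n) - U t (y * u n)) / a t (u n)\<bar> \<le> e * \<bar>lam n * (a s (u n) / a t (u n) + 1)\<bar>"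
        if st: "(s, t) \<in> ?P n" for s t
      proof -
        have a: "0 < a t (u n)" "0 < a s (u n)"
          using pairs[OF st] u_pos[OF elim(2)] by (auto intro!: a_pos)
        have l: "0 < lam n"
          using elim by (intro lam_pos)
        have nonneg: "0 \<le> e * lam n * a t (u n)" "0 \<le> e * lam n * a s (u n)"
          using a l \<open>e > 0\<close> by auto
        \<comment> \<open>\<open>gap\<close> measures in the scale of the second component of a
          pair. Applying it to the pair and to its swap brings in both scales, hence the factor
          \<open>a s (u n) / a t (u n) + 1\<close> after division.\<close>
        have "U t (y * u n) - U s (y * u n) \<le> e * lam n * a t (u n)"
          "U s (y * u n) - U t (y * u n) \<le> e * lam n * a s (u n)"
          using elim(1) st pairs[OF st] by auto
        then have "\<bar>U s (y * u n) - U t (y * u n)\<bar> \<le> e * lam n * a s (u n) + e * lam n * a t (u n)"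
          using nonneg by linarith
        then have "\<bar>U s (y * u n) - U t (y * u n)\<bar> / a t (u n)
            \<le> (e * lam n * a s (u n) + e * lam n * a t (u n)) / a t (u n)"
          using a by (intro divide_right_mono) auto
        also have "\<dots> = e * (lam n * (a s (u n) / a t (u n) + 1))"
          using a by (simp add: field_simps)
        also have "\<dots> = e * \<bar>lam n * (a s (u n) / a t (u n) + 1)\<bar>"
          using a l by (simp add: add_pos_pos)
        finally show ?thesis
          using a by simp
      qed
      then show ?case
        by auto
    qed
  qed

  \<comment> \<open>Condition (M) and bounds along close pairs\<close>
  have expansion: "(\<lambda>z. (U (fst (snd z)) (snd (snd z) * u (fst z)) - U (fst (snd z)) (u (fst z)))
        / a (fst (snd z)) (u (fst z)) - box_cox (\<gamma> (fst (snd z))) (snd (snd z))) \<in>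
      o[uniformly_in (\<lambda>_. {0..1} \<times> {y\<^sub>0..y\<^sub>1})](\<lambda>z. lam (fst z))"
    if "0 < y\<^sub>0" "y\<^sub>0 < y\<^sub>1" for y\<^sub>0 y\<^sub>1
    using cond_M[OF that]
    unfolding smallo_iff by (simp add: u_def case_prod_unfold)
  have pull: "(\<lambda>z. (U (f (snd z)) (y * u (fst z)) - U (f (snd z)) (u (fst z)))
        / a (f (snd z)) (u (fst z)) - box_cox (\<gamma> (f (snd z))) y) \<in> o[?F](\<lambda>z. lam (fst z))"
    if "y > 0" and f: "\<And>n x. x \<in> ?P n \<Longrightarrow> f x \<in> {0..1}" for y and f :: "real \<times> real \<Rightarrow> real"
  proof -
    \<comment> \<open>(M) is stated for nondegenerate intervals, so a fixed \<open>y\<close> is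
      placed in \<open>{y..y + 1}\<close>.\<close>
    have "filterlim (\<lambda>z. (fst z, (\<lambda>x. (f x, y)) (snd z))) (uniformly_in (\<lambda>_. {0..1} \<times> {y..y + 1})) ?F"
      using f by (intro filterlim_uniformly_in) auto
    from landau_o.small.compose[OF expansion[OF \<open>y > 0\<close>] this] show ?thesis
      by simp
  qed
  have pos: "\<forall>\<^sub>F z in ?F. a (fst (snd z)) (u (fst z)) > 0 \<and> a (snd (snd z)) (u (fst z)) > 0"
    unfolding eventually_uniformly_in using eventually_ge_at_top[of 1]
  proof eventually_elim
    case (elim n)
    then show ?case
      using pairs u_pos[of n] by (auto intro!: a_pos)
  qed
  have G': "\<forall>\<^sub>F z in ?F. \<bar>\<gamma> (fst (snd z))\<bar> \<le> G \<and> \<bar>\<gamma> (snd (snd z))\<bar> \<le> G"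
    unfolding eventually_uniformly_in using pairs G by (intro always_eventually) auto
  have lam_O1: "(\<lambda>z. lam (fst z)) \<in> O[uniformly_in S](\<lambda>_. 1)" for S :: "nat \<Rightarrow> 'i set"
  proof (rule bigoI)
    show "\<forall>\<^sub>F z in uniformly_in S. norm (lam (fst z)) \<le> \<Lambda> * norm (1::real)"
      unfolding eventually_uniformly_in using eventually_ge_at_top[of 1]
    proof eventually_elim
      case (elim n)
      then show ?case
        using lam_pos[of n] \<Lambda>(1)[of n] by simp
    qed
  qed

  \<comment> \<open>Identification of index, scale and location\<close>
  have "2 * w > 0"
    using w by simp
  have results:
    "(\<lambda>z. \<gamma> (fst (snd z)) - \<gamma> (snd (snd z))) \<in> o[?F](\<lambda>z. lam (fst z))"
    "(\<lambda>z. a (fst (snd z)) (u (fst z)) / a (snd (snd z)) (u (fst z)) - 1) \<in> o[?F](\<lambda>z. lam (fst z))"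
    "(\<lambda>z. (U (fst (snd z)) (1 * u (fst z)) - U (snd (snd z)) (1 * u (fst z)))
      / a (snd (snd z)) (u (fst z))) \<in> o[?F](\<lambda>z. lam (fst z))"
  proof -
    \<comment> \<open>Taking \<open>v = 2 * w\<close> puts all three points where
      \<open>close\<close> applies. The argument 1 is below this range, so closeness there comes out
      of the transfer.\<close>
    let ?Y = "{2 * w, 2 * (2 * w), 4 * (2 * w)}"
    let ?Q = "\<lambda>y z. U (fst (snd z)) (y * u (fst z))" and ?Q' = "\<lambda>y z. U (snd (snd z)) (y * u (fst z))"
    have Y: "0 < y" "2 * w \<le> y" if "y \<in> ?Y" for y
      using that w by auto
    have fst_in: "fst x \<in> {0..1}" and snd_in: "snd x \<in> {0..1}" if "x \<in> ?P n" for n x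
      using pairs[of "fst x" "snd x" n] that by auto
    have 1: "(\<lambda>z. (?Q y z - ?Q 1 z) / a (fst (snd z)) (u (fst z)) - box_cox (\<gamma> (fst (snd z))) y)
        \<in> o[?F](\<lambda>z. lam (fst z))" if "y \<in> ?Y" for y
      unfolding mult_1_left using Y(1)[OF that] fst_in by (rule pull)
    have 2: "(\<lambda>z. (?Q' y z - ?Q' 1 z) / a (snd (snd z)) (u (fst z)) - box_cox (\<gamma> (snd (snd z))) y)
        \<in> o[?F](\<lambda>z. lam (fst z))" if "y \<in> ?Y" for y
      unfolding mult_1_left using Y(1)[OF that] snd_in by (rule pull)
    note transfer = quantile_expansion_transfer
      [OF pos G' lam_O1 \<open>2 * w > 0\<close>, where Q = ?Q and Q' = ?Q', OF 1 2 close[OF Y(2)]]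
    show "(\<lambda>z. \<gamma> (fst (snd z)) - \<gamma> (snd (snd z))) \<in> o[?F](\<lambda>z. lam (fst z))"
      by (rule transfer(1))
    show "(\<lambda>z. a (fst (snd z)) (u (fst z)) / a (snd (snd z)) (u (fst z)) - 1) \<in> o[?F](\<lambda>z. lam (fst z))"
      by (rule transfer(2))
    show "(\<lambda>z. (?Q 1 z - ?Q' 1 z) / a (snd (snd z)) (u (fst z))) \<in> o[?F](\<lambda>z. lam (fst z))"
      by (rule transfer(3))
  qed

  \<comment> \<open>The expansion at general arguments\<close>
  have main: "sup_smallo (\<lambda>n. ?P n \<times> {y\<^sub>0..y\<^sub>1})
        (\<lambda>n ((s, t), y). (U s (y * u n) - U t (u n)) / a t (u n) - box_cox (\<gamma> t) y) lam"
    if y: "0 < y\<^sub>0" "y\<^sub>0 < y\<^sub>1" for y\<^sub>0 y\<^sub>1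
  proof -
    let ?S = "\<lambda>n. ?P n \<times> {y\<^sub>0..y\<^sub>1}"
    have lim: "filterlim (\<lambda>z. (fst z, fst (snd z))) ?F (uniformly_in ?S)"
      by (rule filterlim_uniformly_in) auto
    \<comment> \<open>The index \<open>((s, t), y)\<close> is sent to \<open>(s, y)\<close>, so (M)
      is used at \<open>s\<close>; the shift then replaces the parameters of \<open>s\<close> by
      those of \<open>t\<close>.\<close>
    have "filterlim (\<lambda>z. (fst z, (\<lambda>x. (fst (fst x), snd x)) (snd z)))
        (uniformly_in (\<lambda>_. {0..1} \<times> {y\<^sub>0..y\<^sub>1})) (uniformly_in ?S)"
      using pairs by (intro filterlim_uniformly_in) auto
    from landau_o.small.compose[OF expansion[OF y] this]
    have ex: "(\<lambda>z. (U (fst (fst (snd z))) (snd (snd z) * u (fst z)) - U (fst (fst (snd z))) (u (fst z)))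
        / a (fst (fst (snd z))) (u (fst z)) - box_cox (\<gamma> (fst (fst (snd z)))) (snd (snd z))) \<in>
      o[uniformly_in ?S](\<lambda>z. lam (fst z))"
      by simp
    have in_S: "\<forall>\<^sub>F z in uniformly_in ?S. y\<^sub>0 \<le> snd (snd z) \<and> snd (snd z) \<le> y\<^sub>1"
      unfolding eventually_uniformly_in by (intro always_eventually) auto
    have "(\<lambda>z. (U (fst (fst (snd z))) (snd (snd z) * u (fst z)) - U (snd (fst (snd z))) (u (fst z)))
        / a (snd (fst (snd z))) (u (fst z)) - box_cox (\<gamma> (snd (fst (snd z)))) (snd (snd z))) \<in>
      o[uniformly_in ?S](\<lambda>z. lam (fst z))"
      using eventually_compose_filterlim[OF pos lim] eventually_compose_filterlim[OF G' lim]
        landau_o.small.compose[OF results(1) lim] landau_o.small.compose[OF results(2) lim]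
        landau_o.small.compose[OF results(3) lim]
      by (intro quantile_expansion_shift[OF _ _ y(1) in_S lam_O1 ex]) simp_all
    then show ?thesis
      unfolding smallo_iff by (simp add: case_prod_unfold)
  qed
  show ?thesis
    using main results unfolding smallo_iff by (simp add: u_def case_prod_unfold)
qed

end
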